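(* Let $(\mathscr{O},\eta,e)$ be an operad. Then $(\mathscr{O}',\mathscr{O})$ with product $(\rho,\eta)$, where $\rho=\eta'$, and identity $(\mathfrak{e},e)$, where $\mathfrak{e}=e'$, is a monop.
   Context: Species, product $\cdot$, substitution $R(P)$ (for $P$ positive), species $1$ and $X$, operads $(\mathscr O,\eta:\mathscr O(\mathscr O)\to\mathscr O, e:X\to\mathscr O)$ are as usual in the theory of combinatorial species: $(M\cdot N)[V]=\sum_{V_1+V_2=V}M[V_1]\times N[V_2]$; $R(P)[V]=\sum_{\pi}(\prod_{B\in\pi}P[B])\times R[\pi]$ over partitions $\pi$ of $V$; $1[\emptyset]=\{\emptyset\}$, $1[V]=\emptyset$ for $V\neq\emptyset$; $X[V]=V$ if $|V|=1$, else $\emptyset$; an operad is a monoid for substitution on positive species (associative product $\eta$ with two-sided unit $e$). The derivative of a species $F$ is $F'[V]=F[V+\{\ast\}]$ ($\ast$ a new point), and of a morphism $\phi$ is $\phi'_V=\phi_{V+\{\ast\}}$. By the chain rule $(\mathscr{O}(\mathscr{O}))'\cong\mathscr{O}'(\mathscr{O})\cdot\mathscr{O}'\cong\mathscr{O}'\cdot\mathscr{O}'(\mathscr{O})$ and $X'\cong 1$, so $\eta'$ is regarded as a morphism $\mathscr{O}'\cdot\mathscr{O}'(\mathscr{O})\to\mathscr{O}'$ and $e'$ as a morphism $1\to\mathscr{O}'$. Riordan category: objects are pairs $(M,\mathscr{O})$ of species with $\mathscr{O}$ positive; monoidal product $(M_1,\mathscr{O}_1)\ast(M_2,\mathscr{O}_2)=(M_1\cdot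 M_2(\mathscr{O}_1),\mathscr{O}_2(\mathscr{O}_1))$, on morphisms $(\phi_1,\psi_1)\ast(\phi_2,\psi_2)=(\phi_1\cdot\phi_2(\psi_1),\psi_2(\psi_1))$, unit $(1,X)$; associativity isomorphism: associativity of substitution in the second component, and in the first component associativity of product composed with the canonical isomorphisms $(A\cdot B)(C)\cong A(C)\cdot B(C)$, $A(B)(C)\cong A(B(C))$. A monop is a monoid in this category, i.e. a pair $(M,\mathscr{O})$ with $(\rho,\eta):(M,\mathscr{O})\ast(M,\mathscr{O})\to(M,\mathscr{O})$ and $(\mathfrak{e},e):(1,X)\to(M,\mathscr{O})$ satisfying the monoid associativity and unit axioms. *)

theory Defs
  imports "HOL-Library.FSet" "HOL-Library.FuncSet" "HOL-Library.Disjoint_Sets"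
begin

text \<open>Labels form a universe over arbitrary atoms in which every finite set of labels is again a
  label. So a species can be evaluated on the set of blocks of a partition, and every finite set
  \<open>V\<close> of labels comes with a label outside \<open>V\<close>.\<close>

datatype 'a label = Atom 'a | Block "'a label fset"

definition blk :: "'a label set \<Rightarrow> 'a label" where
  "blk B = Block (Abs_fset B)"

primrec unblk :: "'a label \<Rightarrow> 'a label set" where
  "unblk (Atom a) = {}"
| "unblk (Block b) = fset b"

lemma unblk_blk [simp]: "finite B \<Longrightarrow> unblk (blk B) = B"
  by (simp add: blk_def Abs_fset_inverse)

text \<open>The new point of \<open>V + {*}\<close> is the set \<open>V\<close> itself.\<close>

definition star :: "'a label set \<Rightarrow> 'a label" where
  "star V = blk V"

definition plus_star :: "'a label set \<Rightarrow> 'a label set" where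
  "plus_star V = insert (star V) V"

lemma star_notin:
  assumes "finite V"
  shows "star V \<notin> V"
proof
  assume a: "star V \<in> V"
  have "x \<notin> unblk x" for x :: "'a label"
  proof (induction x)
    case (Block b)
    from Block[of "Block b"] show ?case by auto
  qed simp
  from this[of "star V"] a assms show False
    by (simp add: star_def)
qed


subsection \<open>Species and their morphisms\<close>

text \<open>\<open>tr F U \<sigma>\<close> is the transport \<open>F[\<sigma>]\<close> along the bijection from \<open>U\<close> onto \<open>\<sigma> ` U\<close>
  given by a function \<open>\<sigma>\<close> that is injective on \<open>U\<close>.\<close>

record ('a, 's) species =
  str :: "'a label set \<Rightarrow> 's set"
  tr :: "'a label set \<Rightarrow> ('a label \<Rightarrow> 'a label) \<Rightarrow> 's \<Rightarrow> 's"

definition is_species :: "('a, 's) species \<Rightarrow> bool" where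
  "is_species F \<longleftrightarrow>
     (\<forall>U. finite U \<longrightarrow> finite (str F U)) \<and>
     (\<forall>U \<sigma>. finite U \<longrightarrow> inj_on \<sigma> U \<longrightarrow> (\<forall>s\<in>str F U. tr F U \<sigma> s \<in> str F (\<sigma> ` U))) \<and>
     (\<forall>U \<sigma> \<tau>. finite U \<longrightarrow> inj_on \<sigma> U \<longrightarrow> (\<forall>x\<in>U. \<sigma> x = \<tau> x) \<longrightarrow>
        (\<forall>s\<in>str F U. tr F U \<sigma> s = tr F U \<tau> s)) \<and>
     (\<forall>U. finite U \<longrightarrow> (\<forall>s\<in>str F U. tr F U id s = s)) \<and>
     (\<forall>U \<sigma> \<tau>. finite U \<longrightarrow> inj_on \<sigma> U \<longrightarrow> inj_on \<tau> (\<sigma> ` U) \<longrightarrow>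
        (\<forall>s\<in>str F U. tr F U (\<tau> \<circ> \<sigma>) s = tr F (\<sigma> ` U) \<tau> (tr F U \<sigma> s)))"

definition positive :: "('a, 's) species \<Rightarrow> bool" where
  "positive F \<longleftrightarrow> str F {} = {}"

type_synonym ('a, 's, 't) mor = "'a label set \<Rightarrow> 's \<Rightarrow> 't"

definition is_mor :: "('a, 's) species \<Rightarrow> ('a, 't) species \<Rightarrow> ('a, 's, 't) mor \<Rightarrow> bool" where
  "is_mor F G \<phi> \<longleftrightarrow>
     (\<forall>U. finite U \<longrightarrow> (\<forall>s\<in>str F U. \<phi> U s \<in> str G U)) \<and>
     (\<forall>U \<sigma>. finite U \<longrightarrow> inj_on \<sigma> U \<longrightarrow>
        (\<forall>s\<in>str F U. \<phi> (\<sigma> ` U) (tr F U \<sigma> s) = tr G U \<sigma> (\<phi> U s)))"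

text \<open>Equality of morphisms with domain \<open>F\<close>.\<close>

definition mor_eq :: "('a, 's) species \<Rightarrow> ('a, 's, 't) mor \<Rightarrow> ('a, 's, 't) mor \<Rightarrow> bool" where
  "mor_eq F \<phi> \<psi> \<longleftrightarrow> (\<forall>U. finite U \<longrightarrow> (\<forall>s\<in>str F U. \<phi> U s = \<psi> U s))"

definition mor_id :: "('a, 's, 's) mor" where
  "mor_id U s = s"

definition mor_comp :: "('a, 't, 'u) mor \<Rightarrow> ('a, 's, 't) mor \<Rightarrow> ('a, 's, 'u) mor"
    (infixl "\<circ>\<^sub>s" 65) where
  "(\<phi> \<circ>\<^sub>s \<psi>) U s = \<phi> U (\<psi> U s)"


subsection \<open>The species \<open>1\<close> and \<open>X\<close>, product, substitution, derivative\<close>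

definition sp_one :: "('a, 'a label set) species" where
  "sp_one = \<lparr>str = \<lambda>V. if V = {} then {{}} else {}, tr = \<lambda>V \<sigma> s. s\<rparr>"

definition sp_X :: "('a, 'a label) species" where
  "sp_X = \<lparr>str = \<lambda>V. if card V = 1 then V else {}, tr = \<lambda>V \<sigma> x. \<sigma> x\<rparr>"

type_synonym ('a, 's, 't) prod_str = "('a label set \<times> 'a label set) \<times> ('s \<times> 't)"

definition sp_prod ::
    "('a, 's) species \<Rightarrow> ('a, 't) species \<Rightarrow> ('a, ('a, 's, 't) prod_str) species" where
  "sp_prod M N =
     \<lparr>str = \<lambda>V. {((V1, V2), (m, n)) | V1 V2 m n.
              V1 \<union> V2 = V \<and> V1 \<inter> V2 = {} \<and> m \<in> str M V1 \<and> n \<in> str N V2},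
      tr = \<lambda>V \<sigma> ((V1, V2), (m, n)). ((\<sigma> ` V1, \<sigma> ` V2), (tr M V1 \<sigma> m, tr N V2 \<sigma> n))\<rparr>"

definition prod_mor ::
    "('a, 's, 's2) mor \<Rightarrow> ('a, 't, 't2) mor \<Rightarrow> ('a, ('a, 's, 't) prod_str, ('a, 's2, 't2) prod_str) mor"
  where
  "prod_mor \<phi> \<psi> = (\<lambda>V ((V1, V2), (m, n)). ((V1, V2), (\<phi> V1 m, \<psi> V2 n)))"

text \<open>An \<open>R(P)\<close>-structure on \<open>V\<close> is \<open>(\<pi>, f, r)\<close> with \<open>\<pi>\<close> a partition of \<open>V\<close>, \<open>f\<close> a family of
  \<open>P\<close>-structures on its blocks and \<open>r\<close> an \<open>R\<close>-structure on the set of blocks. Families are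
  extensional functions, so that they are determined by their values on \<open>\<pi>\<close>.\<close>

type_synonym ('a, 's, 't) subst_str = "'a label set set \<times> ('a label set \<Rightarrow> 't) \<times> 's"

definition sp_subst ::
    "('a, 's) species \<Rightarrow> ('a, 't) species \<Rightarrow> ('a, ('a, 's, 't) subst_str) species" where
  "sp_subst R P =
     \<lparr>str = \<lambda>V. {(\<pi>, f, r) | \<pi> f r.
              partition_on V \<pi> \<and> f \<in> (\<Pi>\<^sub>E B\<in>\<pi>. str P B) \<and> r \<in> str R (blk ` \<pi>)},
      tr = \<lambda>V \<sigma> (\<pi>, f, r).
              ((`) \<sigma> ` \<pi>,
               \<lambda>C\<in>(`) \<sigma> ` \<pi>. let B = {x \<in> V. \<sigma> x \<in> C} in tr P B \<sigma> (f B),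
               tr R (blk ` \<pi>) (\<lambda>x. blk (\<sigma> ` unblk x)) r)\<rparr>"

definition subst_mor ::
    "('a, 's, 's2) mor \<Rightarrow> ('a, 't, 't2) mor \<Rightarrow> ('a, ('a, 's, 't) subst_str, ('a, 's2, 't2) subst_str) mor"
  where
  "subst_mor \<phi> \<psi> = (\<lambda>V (\<pi>, f, r). (\<pi>, \<lambda>B\<in>\<pi>. \<psi> B (f B), \<phi> (blk ` \<pi>) r))"

definition deriv :: "('a, 's) species \<Rightarrow> ('a, 's) species" where
  "deriv F =
     \<lparr>str = \<lambda>V. str F (plus_star V),
      tr = \<lambda>V \<sigma>. tr F (plus_star V) (\<sigma>(star V := star (\<sigma> ` V)))\<rparr>"

definition deriv_mor :: "('a, 's, 't) mor \<Rightarrow> ('a, 's, 't) mor" where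
  "deriv_mor \<phi> V = \<phi> (plus_star V)"


subsection \<open>Canonical isomorphisms\<close>

text \<open>\<open>A \<cdot> (B \<cdot> C) \<rightarrow> (A \<cdot> B) \<cdot> C\<close>, \<open>M \<cdot> N \<rightarrow> N \<cdot> M\<close>, \<open>1 \<cdot> N \<rightarrow> N\<close> and \<open>N \<cdot> 1 \<rightarrow> N\<close>\<close>

definition prod_assoc ::
    "('a, ('a, 's, ('a, 't, 'u) prod_str) prod_str, ('a, ('a, 's, 't) prod_str, 'u) prod_str) mor" where
  "prod_assoc = (\<lambda>V ((V1, W), (a, ((V2, V3), (b, c)))).
     ((V1 \<union> V2, V3), (((V1, V2), (a, b)), c)))"

definition prod_swap :: "('a, ('a, 's, 't) prod_str, ('a, 't, 's) prod_str) mor" where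
  "prod_swap = (\<lambda>V ((V1, V2), (m, n)). ((V2, V1), (n, m)))"

definition prod_lunit :: "('a, ('a, 'a label set, 's) prod_str, 's) mor" where
  "prod_lunit = (\<lambda>V ((V1, V2), (z, n)). n)"

definition prod_runit :: "('a, ('a, 's, 'a label set) prod_str, 's) mor" where
  "prod_runit = (\<lambda>V ((V1, V2), (n, z)). n)"

text \<open>\<open>(A \<cdot> B)(C) \<rightarrow> A(C) \<cdot> B(C)\<close>: the set of blocks is split into \<open>K1\<close> and \<open>K2\<close>.\<close>

definition subst_distrib ::
    "('a, ('a, ('a, 's, 't) prod_str, 'u) subst_str,
      ('a, ('a, 's, 'u) subst_str, ('a, 't, 'u) subst_str) prod_str) mor" where
  "subst_distrib = (\<lambda>V (\<pi>, f, ((K1, K2), (a, b))).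
     let \<pi>1 = unblk ` K1; \<pi>2 = unblk ` K2
     in ((\<Union>\<pi>1, \<Union>\<pi>2), ((\<pi>1, restrict f \<pi>1, a), (\<pi>2, restrict f \<pi>2, b))))"

text \<open>\<open>A(B)(C) \<rightarrow> A(B(C))\<close>: given a partition \<open>\<pi>\<close> of \<open>V\<close> and a partition \<open>\<kappa>\<close> of its set of blocks,
  each \<open>K \<in> \<kappa>\<close> yields the block \<open>\<Union>K\<close> of a coarser partition of \<open>V\<close>. Such a block \<open>D\<close> is partitioned
  by the blocks of \<open>\<pi>\<close> contained in it, and these make up \<open>K\<close>.\<close>

definition subst_assoc ::
    "('a, 's) species \<Rightarrow>
     ('a, ('a, ('a, 's, 't) subst_str, 'u) subst_str, ('a, 's, ('a, 't, 'u) subst_str) subst_str) mor" where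
  "subst_assoc A = (\<lambda>V (\<pi>, f, (\<kappa>, g, a)).
     let \<pi>' = (\<lambda>K. \<Union>(unblk ` K)) ` \<kappa>
     in (\<pi>',
         \<lambda>D\<in>\<pi>'. let \<pi>D = {B \<in> \<pi>. B \<subseteq> D} in (\<pi>D, restrict f \<pi>D, g (blk ` \<pi>D)),
         tr A (blk ` \<kappa>) (\<lambda>x. blk (\<Union>(unblk ` unblk x))) a))"

text \<open>\<open>X(P) \<rightarrow> P\<close>: there is a single block, \<open>V\<close>.\<close>

definition subst_lunit :: "('a, ('a, 'a label, 's) subst_str, 's) mor" where
  "subst_lunit = (\<lambda>V (\<pi>, f, x). f V)"

text \<open>\<open>A(X) \<rightarrow> A\<close>: the blocks are singletons and the structure on \<open>{v}\<close> is \<open>v\<close>, so \<open>f\<close> identifies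
  the set of blocks with \<open>V\<close>.\<close>

definition subst_runit :: "('a, 's) species \<Rightarrow> ('a, ('a, 's, 'a label) subst_str, 's) mor" where
  "subst_runit A = (\<lambda>V (\<pi>, f, a). tr A (blk ` \<pi>) (\<lambda>x. f (unblk x)) a)"

text \<open>\<open>1(P) \<rightarrow> 1\<close>\<close>

definition subst_one :: "('a, ('a, 'a label set, 's) subst_str, 'a label set) mor" where
  "subst_one = (\<lambda>V (\<pi>, f, z). z)"

text \<open>The chain rule \<open>R'(P) \<cdot> P' \<rightarrow> (R(P))'\<close>: the \<open>P'\<close>-structure on \<open>V1\<close> becomes a \<open>P\<close>-structure on
  the block \<open>B0 = V1 + {*}\<close>, where \<open>*\<close> is now the new point of \<open>V\<close>, and the new point of the set of
  blocks of \<open>\<pi>\<close> becomes \<open>B0\<close>.\<close>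

definition chain_rule ::
    "('a, 's) species \<Rightarrow> ('a, 't) species \<Rightarrow>
     ('a, ('a, ('a, 's, 't) subst_str, 't) prod_str, ('a, 's, 't) subst_str) mor" where
  "chain_rule R P = (\<lambda>V ((V2, V1), ((\<pi>, f, r), p)).
     let B0 = insert (star V) V1
     in (insert B0 \<pi>,
         \<lambda>B\<in>insert B0 \<pi>. if B = B0 then tr P (plus_star V1) (id(star V1 := star V)) p else f B,
         tr R (plus_star (blk ` \<pi>)) (id(star (blk ` \<pi>) := blk B0)) r))"

text \<open>\<open>1 \<rightarrow> X'\<close>\<close>

definition one_deriv_X :: "('a, 'a label set, 'a label) mor" where
  "one_deriv_X = (\<lambda>V z. star V)"


subsection \<open>Operads\<close>

definition operad ::
    "('a, 's) species \<Rightarrow> ('a, ('a, 's, 's) subst_str, 's) mor \<Rightarrow> ('a, 'a label, 's) mor \<Rightarrow> bool" where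
  "operad P \<eta> e \<longleftrightarrow>
     is_species P \<and> positive P \<and>
     is_mor (sp_subst P P) P \<eta> \<and> is_mor sp_X P e \<and>
     mor_eq (sp_subst (sp_subst P P) P)
       (\<eta> \<circ>\<^sub>s subst_mor mor_id \<eta> \<circ>\<^sub>s subst_assoc P)
       (\<eta> \<circ>\<^sub>s subst_mor \<eta> mor_id) \<and>
     mor_eq (sp_subst sp_X P) (\<eta> \<circ>\<^sub>s subst_mor e mor_id) subst_lunit \<and>
     mor_eq (sp_subst P sp_X) (\<eta> \<circ>\<^sub>s subst_mor mor_id e) (subst_runit P)"


subsection \<open>The Riordan category and monops\<close>

type_synonym ('a, 'm, 's) riordan_obj = "('a, 'm) species \<times> ('a, 's) species"

type_synonym ('a, 'm, 's, 'n, 't) riordan_mor = "('a, 'm, 'n) mor \<times> ('a, 's, 't) mor"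

fun is_riordan_obj :: "('a, 'm, 's) riordan_obj \<Rightarrow> bool" where
  "is_riordan_obj (M, P) \<longleftrightarrow> is_species M \<and> is_species P \<and> positive P"

fun is_riordan_mor ::
    "('a, 'm, 's) riordan_obj \<Rightarrow> ('a, 'n, 't) riordan_obj \<Rightarrow> ('a, 'm, 's, 'n, 't) riordan_mor \<Rightarrow> bool" where
  "is_riordan_mor (M, P) (N, Q) (\<phi>, \<psi>) \<longleftrightarrow> is_mor M N \<phi> \<and> is_mor P Q \<psi>"

fun riordan_eq ::
    "('a, 'm, 's) riordan_obj \<Rightarrow> ('a, 'm, 's, 'n, 't) riordan_mor \<Rightarrow> ('a, 'm, 's, 'n, 't) riordan_mor
     \<Rightarrow> bool" where
  "riordan_eq (M, P) (\<phi>1, \<psi>1) (\<phi>2, \<psi>2) \<longleftrightarrow> mor_eq M \<phi>1 \<phi>2 \<and> mor_eq P \<psi>1 \<psi>2"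

definition riordan_id :: "('a, 'm, 's, 'm, 's) riordan_mor" where
  "riordan_id = (mor_id, mor_id)"

fun riordan_comp ::
    "('a, 'n, 't, 'k, 'u) riordan_mor \<Rightarrow> ('a, 'm, 's, 'n, 't) riordan_mor
     \<Rightarrow> ('a, 'm, 's, 'k, 'u) riordan_mor" (infixl "\<circ>\<^sub>R" 65) where
  "(\<phi>2, \<psi>2) \<circ>\<^sub>R (\<phi>1, \<psi>1) = (\<phi>2 \<circ>\<^sub>s \<phi>1, \<psi>2 \<circ>\<^sub>s \<psi>1)"

fun riordan_prod ::
    "('a, 'm, 's) riordan_obj \<Rightarrow> ('a, 'n, 't) riordan_obj
     \<Rightarrow> ('a, ('a, 'm, ('a, 'n, 's) subst_str) prod_str, ('a, 't, 's) subst_str) riordan_obj"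
    (infixr "\<star>" 70) where
  "(M1, P1) \<star> (M2, P2) = (sp_prod M1 (sp_subst M2 P1), sp_subst P2 P1)"

fun riordan_prod_mor ::
    "('a, 'm, 's, 'm2, 's2) riordan_mor \<Rightarrow> ('a, 'n, 't, 'n2, 't2) riordan_mor
     \<Rightarrow> ('a, ('a, 'm, ('a, 'n, 's) subst_str) prod_str, ('a, 't, 's) subst_str,
         ('a, 'm2, ('a, 'n2, 's2) subst_str) prod_str, ('a, 't2, 's2) subst_str) riordan_mor"
    (infixr "\<star>\<^sub>m" 70) where
  "(\<phi>1, \<psi>1) \<star>\<^sub>m (\<phi>2, \<psi>2) = (prod_mor \<phi>1 (subst_mor \<phi>2 \<psi>1), subst_mor \<psi>2 \<psi>1)"

definition riordan_unit :: "('a, 'a label set, 'a label) riordan_obj" where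
  "riordan_unit = (sp_one, sp_X)"

text \<open>\<open>A \<star> (B \<star> C) \<rightarrow> (A \<star> B) \<star> C\<close>; in the first component
  \<open>M1 \<cdot> (M2 \<cdot> M3(P2))(P1) \<rightarrow> M1 \<cdot> (M2(P1) \<cdot> M3(P2)(P1)) \<rightarrow> M1 \<cdot> (M2(P1) \<cdot> M3(P2(P1)))
  \<rightarrow> (M1 \<cdot> M2(P1)) \<cdot> M3(P2(P1))\<close>. The first two objects enter only through their types.\<close>

fun riordan_assoc ::
    "('a, 'm1, 's1) riordan_obj \<Rightarrow> ('a, 'm2, 's2) riordan_obj \<Rightarrow> ('a, 'm3, 's3) riordan_obj
     \<Rightarrow> ('a,
         ('a, 'm1, ('a, ('a, 'm2, ('a, 'm3, 's2) subst_str) prod_str, 's1) subst_str) prod_str,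
         ('a, ('a, 's3, 's2) subst_str, 's1) subst_str,
         ('a, ('a, 'm1, ('a, 'm2, 's1) subst_str) prod_str, ('a, 'm3, ('a, 's2, 's1) subst_str) subst_str)
           prod_str,
         ('a, 's3, ('a, 's2, 's1) subst_str) subst_str) riordan_mor" where
  "riordan_assoc (M1, P1) (M2, P2) (M3, P3) =
     (prod_assoc \<circ>\<^sub>s prod_mor mor_id (prod_mor mor_id (subst_assoc M3)) \<circ>\<^sub>s prod_mor mor_id subst_distrib,
      subst_assoc P3)"

text \<open>\<open>(1, X) \<star> (M, P) = (1 \<cdot> M(X), P(X)) \<rightarrow> (M, P)\<close>\<close>

fun riordan_lunit ::
    "('a, 'm, 's) riordan_obj
     \<Rightarrow> ('a, ('a, 'a label set, ('a, 'm, 'a label) subst_str) prod_str, ('a, 's, 'a label) subst_str,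
         'm, 's) riordan_mor" where
  "riordan_lunit (M, P) = (subst_runit M \<circ>\<^sub>s prod_lunit, subst_runit P)"

text \<open>\<open>(M, P) \<star> (1, X) = (M \<cdot> 1(P), X(P)) \<rightarrow> (M, P)\<close>\<close>

definition riordan_runit ::
    "('a, ('a, 'm, ('a, 'a label set, 's) subst_str) prod_str, ('a, 'a label, 's) subst_str,
      'm, 's) riordan_mor" where
  "riordan_runit = (prod_runit \<circ>\<^sub>s prod_mor mor_id subst_one, subst_lunit)"

definition monop ::
    "('a, 'm, 's) riordan_obj
     \<Rightarrow> ('a, ('a, 'm, ('a, 'm, 's) subst_str) prod_str, ('a, 's, 's) subst_str, 'm, 's) riordan_mor
     \<Rightarrow> ('a, 'a label set, 'a label, 'm, 's) riordan_mor \<Rightarrow> bool" where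
  "monop A \<mu> \<iota> \<longleftrightarrow>
     is_riordan_obj A \<and>
     is_riordan_mor (A \<star> A) A \<mu> \<and> is_riordan_mor riordan_unit A \<iota> \<and>
     riordan_eq (A \<star> (A \<star> A))
       (\<mu> \<circ>\<^sub>R (\<mu> \<star>\<^sub>m riordan_id) \<circ>\<^sub>R riordan_assoc A A A)
       (\<mu> \<circ>\<^sub>R (riordan_id \<star>\<^sub>m \<mu>)) \<and>
     riordan_eq (riordan_unit \<star> A) (\<mu> \<circ>\<^sub>R (\<iota> \<star>\<^sub>m riordan_id)) (riordan_lunit A) \<and>
     riordan_eq (A \<star> riordan_unit) (\<mu> \<circ>\<^sub>R (riordan_id \<star>\<^sub>m \<iota>)) riordan_runit"

end

theory Submission
  imports Defs
begin

text \<open>Unfolding the chain rule, the product \<open>\<rho> = \<eta>'\<close> evaluates \<open>\<eta>\<close> at an \<open>O(O)\<close>-structure on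
  \<open>V + {*}\<close> whose distinguished block is the one containing \<open>*\<close>. By naturality of \<open>\<eta>\<close> the point \<open>*\<close>
  may be replaced by any other new point. Hence a structure in the domain of the associativity
  axiom for \<open>\<rho>\<close> amounts to an \<open>O(O)(O)\<close>-structure on \<open>V + {*}\<close>, and the axiom is associativity of \<open>\<eta>\<close>
  at that structure; the unit axioms for \<open>\<rho>\<close> likewise are those for \<open>\<eta>\<close> on \<open>V + {*}\<close>.\<close>

text \<open>The obstacle is the identity of the new points. The new point of a set \<open>U\<close>
  is fixed as the label \<open>star U\<close>, so structures of \<open>deriv P\<close> on different
  sets carry different new points, and in an iterated product an inner one is in general not the new
  point of the whole. Every comparison therefore renames a new point to a prescribed label:
  \<open>repoint\<close> does this for a single structure, and \<open>graft\<close> is the chain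
  rule with that label as a parameter.

  A structure of \<open>deriv P\<close> is best seen as a \<open>P\<close>-structure with one marked
  slot. In a threefold product the three marked structures lie along the path from the root to the
  new point of \<open>V\<close>: the slot of the root receives a block of blocks, the slot of the
  next structure a block of points, and the slot of the last one the new point itself. Filling the
  slots in this way, with everything off the path unchanged, gives the structure at which
  associativity of \<open>\<eta>\<close> is used.\<close>

lemma unblk_blk_image:
  assumes "\<And>B. B \<in> \<pi> \<Longrightarrow> finite B"
  shows "unblk ` blk ` \<pi> = \<pi>"
  using assms by (force simp: image_iff)

lemma blk_eq_iff:
  assumes "finite B" "finite C"
  shows "blk B = blk C \<longleftrightarrow> B = C"
  using assms by (metis unblk_blk)

lemma partition_on_finite_block:
  assumes "partition_on V \<pi>" "finite V" "B \<in> \<pi>"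
  shows "finite B"
  using assms by (metis finite_subset partition_onD1 Union_upper)

section \<open>Elementary laws of transport and of morphisms\<close>

lemma tr_in:
  assumes "is_species F" "finite U" "inj_on \<sigma> U" "\<sigma> ` U = W" "s \<in> str F U"
  shows "tr F U \<sigma> s \<in> str F W"
proof -
  have "\<forall>U \<sigma>. finite U \<longrightarrow> inj_on \<sigma> U \<longrightarrow> (\<forall>s\<in>str F U. tr F U \<sigma> s \<in> str F (\<sigma> ` U))"
    using assms(1) unfolding is_species_def by (elim conjE)
  then show ?thesis using assms(2-5) by auto
qed

lemma tr_cong:
  assumes "is_species F" "finite U" "inj_on \<sigma> U" "s \<in> str F U" "\<And>x. x \<in> U \<Longrightarrow> \<sigma> x = \<tau> x"
  shows "tr F U \<sigma> s = tr F U \<tau> s"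
proof -
  have "\<forall>U \<sigma> \<tau>. finite U \<longrightarrow> inj_on \<sigma> U \<longrightarrow> (\<forall>x\<in>U. \<sigma> x = \<tau> x) \<longrightarrow>
      (\<forall>s\<in>str F U. tr F U \<sigma> s = tr F U \<tau> s)"
    using assms(1) unfolding is_species_def by (elim conjE)
  then show ?thesis using assms(2-5) by blast
qed

lemma tr_ident:
  assumes "is_species F" "finite U" "s \<in> str F U" "\<And>x. x \<in> U \<Longrightarrow> \<sigma> x = x"
  shows "tr F U \<sigma> s = s"
proof -
  have "\<forall>U. finite U \<longrightarrow> (\<forall>s\<in>str F U. tr F U id s = s)"
    using assms(1) unfolding is_species_def by (elim conjE)
  then have "tr F U id s = s" using assms(2,3) by blast
  moreover have "tr F U id s = tr F U \<sigma> s"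
    by (rule tr_cong[OF assms(1,2)]) (use assms(3,4) in auto)
  ultimately show ?thesis by simp
qed

text \<open>Any \<open>\<upsilon>\<close> that agrees with the composite on \<open>U\<close> is
  allowed, because the maps composed below are function updates at new points, which match only on
  the set in question.\<close>

lemma tr_tr:
  assumes "is_species F" "finite U" "inj_on \<sigma> U" "\<sigma> ` U = W" "inj_on \<tau> W" "s \<in> str F U"
    and "\<And>x. x \<in> U \<Longrightarrow> \<tau> (\<sigma> x) = \<upsilon> x"
  shows "tr F W \<tau> (tr F U \<sigma> s) = tr F U \<upsilon> s"
proof -
  have "\<forall>U \<sigma> \<tau>. finite U \<longrightarrow> inj_on \<sigma> U \<longrightarrow> inj_on \<tau> (\<sigma> ` U) \<longrightarrow>
      (\<forall>s\<in>str F U. tr F U (\<tau> \<circ> \<sigma>) s = tr F (\<sigma> ` U) \<tau> (tr F U \<sigma> s))"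
    using assms(1) unfolding is_species_def by (elim conjE)
  then have "tr F U (\<tau> \<circ> \<sigma>) s = tr F W \<tau> (tr F U \<sigma> s)"
    using assms(2-6) by blast
  moreover have "tr F U (\<tau> \<circ> \<sigma>) s = tr F U \<upsilon> s"
    by (rule tr_cong[OF assms(1,2)]) (use assms(3-7) in \<open>auto intro: comp_inj_on\<close>)
  ultimately show ?thesis by simp
qed

lemma mor_in:
  assumes "is_mor F G \<phi>" "finite U" "s \<in> str F U"
  shows "\<phi> U s \<in> str G U"
  using assms unfolding is_mor_def by simp

lemma mor_natural:
  assumes "is_mor F G \<phi>" "finite U" "inj_on \<sigma> U" "s \<in> str F U" "\<sigma> ` U = W"
  shows "tr G U \<sigma> (\<phi> U s) = \<phi> W (tr F U \<sigma> s)"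
  using assms unfolding is_mor_def by auto

section \<open>The derivative species and the renaming of new points\<close>

lemma finite_plus_star: "finite U \<Longrightarrow> finite (plus_star U)"
  by (simp add: plus_star_def)

lemma inj_on_upd:
  assumes "inj_on \<sigma> U" "x \<notin> U" "y \<notin> \<sigma> ` U"
  shows "inj_on (\<sigma>(x := y)) (insert x U)"
  using assms by (auto simp: inj_on_def)

lemma image_upd:
  assumes "x \<notin> U"
  shows "(\<sigma>(x := y)) ` insert x U = insert y (\<sigma> ` U)"
  using assms by auto

lemma inj_on_star_upd:
  assumes "finite U" "inj_on \<sigma> U" "y \<notin> \<sigma> ` U"
  shows "inj_on (\<sigma>(star U := y)) (plus_star U)"
  unfolding plus_star_def using assms star_notin by (metis inj_on_upd)

lemma image_star_upd:
  assumes "finite U"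
  shows "(\<sigma>(star U := y)) ` plus_star U = insert y (\<sigma> ` U)"
  unfolding plus_star_def using assms star_notin by (metis image_upd)

lemma str_deriv: "str (deriv F) U = str F (plus_star U)"
  by (simp add: deriv_def)

lemma tr_deriv: "tr (deriv F) U \<sigma> = tr F (plus_star U) (\<sigma>(star U := star (\<sigma> ` U)))"
  by (simp add: deriv_def)

lemma is_species_deriv:
  assumes F: "is_species F"
  shows "is_species (deriv F)"
proof -
  have inj: "inj_on (\<sigma>(star U := star (\<sigma> ` U))) (plus_star U)"
    and im: "(\<sigma>(star U := star (\<sigma> ` U))) ` plus_star U = plus_star (\<sigma> ` U)"
    if "finite U" "inj_on \<sigma> U" for U :: "'a label set" and \<sigma> :: "'a label \<Rightarrow> 'a label"
    using that star_notin[of "\<sigma> ` U"] inj_on_star_upd[of U \<sigma>] image_star_upd[of U \<sigma>]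
    by (simp_all add: plus_star_def)
  show ?thesis
    unfolding is_species_def
  proof (intro conjI allI impI ballI)
    fix U :: "'a label set" assume "finite U"
    then show "finite (str (deriv F) U)"
      using F by (simp add: str_deriv is_species_def finite_plus_star)
  next
    fix U :: "'a label set" and \<sigma> :: "'a label \<Rightarrow> 'a label" and s
    assume "finite U" "inj_on \<sigma> U" "s \<in> str (deriv F) U"
    then show "tr (deriv F) U \<sigma> s \<in> str (deriv F) (\<sigma> ` U)"
      unfolding str_deriv tr_deriv by (intro tr_in[OF F] inj im finite_plus_star)
  next
    fix U :: "'a label set" and \<sigma> \<tau> :: "'a label \<Rightarrow> 'a label" and s
    assume *: "finite U" "inj_on \<sigma> U" "\<forall>x\<in>U. \<sigma> x = \<tau> x" "s \<in> str (deriv F) U"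
    then have "\<sigma> ` U = \<tau> ` U" by auto
    then show "tr (deriv F) U \<sigma> s = tr (deriv F) U \<tau> s"
      unfolding tr_deriv
      by (intro tr_cong[OF F] inj finite_plus_star) (use * in \<open>auto simp: str_deriv plus_star_def\<close>)
  next
    fix U :: "'a label set" and s assume "finite U" "s \<in> str (deriv F) U"
    then show "tr (deriv F) U id s = s"
      unfolding tr_deriv by (intro tr_ident[OF F]) (auto simp: str_deriv finite_plus_star)
  next
    fix U :: "'a label set" and \<sigma> \<tau> :: "'a label \<Rightarrow> 'a label" and s
    assume *: "finite U" "inj_on \<sigma> U" "inj_on \<tau> (\<sigma> ` U)" "s \<in> str (deriv F) U"
    show "tr (deriv F) U (\<tau> \<circ> \<sigma>) s = tr (deriv F) (\<sigma> ` U) \<tau> (tr (deriv F) U \<sigma> s)"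
      unfolding tr_deriv
    proof (rule tr_tr[OF F, symmetric])
      fix x assume x: "x \<in> plus_star U"
      show "(\<tau>(star (\<sigma> ` U) := star (\<tau> ` \<sigma> ` U))) ((\<sigma>(star U := star (\<sigma> ` U))) x) =
          ((\<tau> \<circ> \<sigma>)(star U := star ((\<tau> \<circ> \<sigma>) ` U))) x"
      proof (cases "x = star U")
        case False
        then have "\<sigma> x \<in> \<sigma> ` U" using x by (auto simp: plus_star_def)
        \<comment> \<open>The update of \<open>\<tau>\<close> at the intermediate new point
          therefore leaves the values of \<open>\<tau>\<close> on old points alone.\<close>
        then have "\<sigma> x \<noteq> star (\<sigma> ` U)" using star_notin[of "\<sigma> ` U"] *(1) by auto
        then show ?thesis using False by simp
      qed (simp add: image_comp)
    qed (use * in \<open>auto simp: str_deriv finite_plus_star inj im simp del: fun_upd_apply\<close>)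
  qed
qed

text \<open>The canonical bijection from the structures of \<open>deriv F\<close> on
  \<open>U\<close> to the \<open>F\<close>-structures on \<open>U\<close> enlarged by
  \<open>x\<close>, for \<open>x\<close> outside \<open>U\<close>. It makes structures over sets
  with different new points comparable.\<close>

definition repoint :: "('a, 's) species \<Rightarrow> 'a label set \<Rightarrow> 'a label \<Rightarrow> 's \<Rightarrow> 's" where
  "repoint F U x s = tr F (plus_star U) (id(star U := x)) s"

lemma repoint_in:
  assumes "is_species F" "finite U" "x \<notin> U" "s \<in> str (deriv F) U"
  shows "repoint F U x s \<in> str F (insert x U)"
  unfolding repoint_def
  by (rule tr_in[OF assms(1)])
    (use assms in \<open>auto simp: finite_plus_star str_deriv inj_on_star_upd image_star_upd
      simp del: fun_upd_apply\<close>)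

lemma repoint_star:
  assumes "is_species F" "finite U" "s \<in> str (deriv F) U"
  shows "repoint F U (star U) s = s"
  unfolding repoint_def
  by (rule tr_ident[OF assms(1)]) (use assms in \<open>auto simp: finite_plus_star str_deriv\<close>)

lemma tr_repoint:
  assumes "is_species F" "finite U" "x \<notin> U" "s \<in> str (deriv F) U" "inj_on \<sigma> (insert x U)"
    and "\<And>u. u \<in> U \<Longrightarrow> \<tau> u = \<sigma> u" "\<tau> (star U) = \<sigma> x"
  shows "tr F (insert x U) \<sigma> (repoint F U x s) = tr F (plus_star U) \<tau> s"
  unfolding repoint_def
proof (rule tr_tr[OF assms(1)])
  show "inj_on (id(star U := x)) (plus_star U)" "(id(star U := x)) ` plus_star U = insert x U"
    using inj_on_star_upd[of U id x] image_star_upd[of U id x] assms(2,3) by simp_all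
  show "\<sigma> ((id(star U := x)) u) = \<tau> u" if "u \<in> plus_star U" for u
    using that assms star_notin[OF assms(2)] by (auto simp: plus_star_def)
qed (use assms in \<open>auto simp: finite_plus_star str_deriv\<close>)

text \<open>Transport in the derivative sends \<open>star U\<close> to \<open>star W\<close>, and
  the renaming sends \<open>star W\<close> on to \<open>y\<close>. The second map moves no other
  point of the image, as \<open>star W\<close> lies outside \<open>W\<close>.\<close>

lemma repoint_tr_deriv:
  assumes "is_species F" "finite U" "s \<in> str (deriv F) U" "inj_on \<sigma> U" "\<sigma> ` U = W" "y \<notin> W"
    and "\<And>u. u \<in> U \<Longrightarrow> \<tau> u = \<sigma> u" "\<tau> (star U) = y"
  shows "repoint F W y (tr (deriv F) U \<sigma> s) = tr F (plus_star U) \<tau> s"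
  unfolding repoint_def tr_deriv assms(5)
proof (rule tr_tr[OF assms(1)])
  have "finite W" using assms by auto
  then have "star W \<notin> W" by (rule star_notin)
  then show "inj_on (\<sigma>(star U := star W)) (plus_star U)"
    "(\<sigma>(star U := star W)) ` plus_star U = plus_star W"
    "inj_on (id(star W := y)) (plus_star W)"
    using assms \<open>finite W\<close>
    by (auto simp: inj_on_star_upd image_star_upd simp del: fun_upd_apply) (auto simp: plus_star_def)
  show "(id(star W := y)) ((\<sigma>(star U := star W)) x) = \<tau> x" if "x \<in> plus_star U" for x
  proof (cases "x = star U")
    case False
    then have "x \<in> U" using that by (simp add: plus_star_def)
    moreover from this have "\<sigma> x \<noteq> star W" using assms(5) \<open>star W \<notin> W\<close> by (metis imageI)
    ultimately show ?thesis using False assms(7) by simp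
  qed (use assms(8) in simp)
qed (use assms in \<open>auto simp: finite_plus_star str_deriv\<close>)

text \<open>Naturality of renaming: both sides are the transport of \<open>s\<close> along
  \<open>\<sigma>\<close> updated to send \<open>star U\<close> to \<open>y\<close>.\<close>

lemma tr_repoint_eq:
  assumes "is_species F" "finite U" "x \<notin> U" "s \<in> str (deriv F) U" "inj_on \<tau> (insert x U)"
    and "\<And>u. u \<in> U \<Longrightarrow> \<tau> u = \<sigma> u" "W = \<sigma> ` U" "\<tau> x = y"
  shows "tr F (insert x U) \<tau> (repoint F U x s) = repoint F W y (tr (deriv F) U \<sigma> s)"
proof -
  have "inj_on \<sigma> U" using assms(5,6) by (auto simp: inj_on_def)
  have "y \<notin> W" using assms by (auto simp: inj_on_def)
  have "tr F (insert x U) \<tau> (repoint F U x s) = tr F (plus_star U) (\<sigma>(star U := y)) s"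
    by (rule tr_repoint) (use assms star_notin[OF assms(2)] in auto)
  also have "\<dots> = repoint F W y (tr (deriv F) U \<sigma> s)"
    by (rule repoint_tr_deriv[symmetric])
      (use assms \<open>inj_on \<sigma> U\<close> \<open>y \<notin> W\<close> star_notin[OF assms(2)] in auto)
  finally show ?thesis .
qed

section \<open>Transport of substitution structures, and the chain rule at an arbitrary
  point\<close>

lemma in_str_subst:
  "(\<pi>, f, r) \<in> str (sp_subst R P) V \<longleftrightarrow>
     partition_on V \<pi> \<and> f \<in> (\<Pi>\<^sub>E B\<in>\<pi>. str P B) \<and> r \<in> str R (blk ` \<pi>)"
  by (simp add: sp_subst_def)

text \<open>The definition indexes the transported family by image blocks and recovers the original
  block as a preimage. Injectivity of \<open>\<sigma>\<close> makes this preimage the block itself,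
  so the family can be checked block by block on \<open>\<pi>\<close>.\<close>

lemma tr_subst_eqI:
  assumes "finite V" "inj_on \<sigma> V" "partition_on V \<pi>"
    and "\<pi>' = (`) \<sigma> ` \<pi>" "f' \<in> extensional \<pi>'" "\<And>B. B \<in> \<pi> \<Longrightarrow> f' (\<sigma> ` B) = tr P B \<sigma> (f B)"
    and "r' = tr R (blk ` \<pi>) (\<lambda>x. blk (\<sigma> ` unblk x)) r"
  shows "tr (sp_subst R P) V \<sigma> (\<pi>, f, r) = (\<pi>', f', r')"
proof -
  have pre: "{x \<in> V. \<sigma> x \<in> \<sigma> ` B} = B" if "B \<in> \<pi>" for B
  proof -
    have "B \<subseteq> V" using that assms(3) by (auto simp: partition_on_def)
    then show ?thesis using assms(2) by (auto simp: inj_on_def)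
  qed
  have "(\<lambda>C\<in>(`) \<sigma> ` \<pi>. let B = {x \<in> V. \<sigma> x \<in> C} in tr P B \<sigma> (f B)) = f'"
    by (rule extensionalityI[OF restrict_extensional]) (use assms pre in auto)
  then show ?thesis using assms by (simp add: sp_subst_def)
qed

text \<open>This is the map on block labels along which the outer structure is transported;
  injectivity makes the laws of \<open>tr R\<close> applicable to it.\<close>

lemma blk_map_inj_on:
  assumes "finite V" "inj_on \<sigma> V" "partition_on V \<pi>"
  shows "inj_on (\<lambda>x. blk (\<sigma> ` unblk x)) (blk ` \<pi>)"
proof (rule inj_onI)
  fix x y assume "x \<in> blk ` \<pi>" "y \<in> blk ` \<pi>" and eq: "blk (\<sigma> ` unblk x) = blk (\<sigma> ` unblk y)"
  then obtain B C where BC: "B \<in> \<pi>" "C \<in> \<pi>" "x = blk B" "y = blk C" by auto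
  then have fin: "finite B" "finite C" and "B \<subseteq> V" "C \<subseteq> V"
    using assms partition_on_finite_block by (auto simp: partition_on_def)
  moreover from eq BC fin have "\<sigma> ` B = \<sigma> ` C" by (simp add: blk_eq_iff)
  ultimately have "B = C" using assms(2) by (simp add: inj_on_image_eq_iff)
  then show "x = y" using BC by simp
qed

lemma blk_map_image:
  assumes "finite V" "partition_on V \<pi>"
  shows "(\<lambda>x. blk (\<sigma> ` unblk x)) ` blk ` \<pi> = blk ` (`) \<sigma> ` \<pi>"
  unfolding image_image using partition_on_finite_block[OF assms(2,1)] by (intro image_cong) auto

text \<open>Serves \<open>repoint_graft\<close>, where naturality of grafting leaves transports
  along \<open>id\<close>.\<close>

lemma tr_subst_ident:
  assumes "is_species P" "is_species R" "finite V" "t \<in> str (sp_subst R P) V"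
  shows "tr (sp_subst R P) V id t = t"
proof -
  obtain \<pi> f r where t: "t = (\<pi>, f, r)" by (cases t)
  have p: "partition_on V \<pi>" and f: "f \<in> (\<Pi>\<^sub>E B\<in>\<pi>. str P B)" and r: "r \<in> str R (blk ` \<pi>)"
    using assms(4) unfolding t in_str_subst by auto
  have fin: "finite \<pi>" "\<And>B. B \<in> \<pi> \<Longrightarrow> finite B"
    using p assms(3) partition_on_finite_block by (auto intro: finite_elements)
  show ?thesis
    unfolding t
  proof (rule tr_subst_eqI[OF assms(3) _ p])
    show "r = tr R (blk ` \<pi>) (\<lambda>x. blk (id ` unblk x)) r"
      by (rule tr_ident[OF assms(2), symmetric]) (use r fin in auto)
  qed (use f fin in \<open>auto simp: PiE_iff tr_ident[OF assms(1)]\<close>)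
qed

text \<open>The chain rule with an arbitrary point \<open>x\<close> in place of the new point.\<close>

definition graft ::
    "('a, 's) species \<Rightarrow> ('a, 't) species \<Rightarrow> 'a label \<Rightarrow> 'a label set \<Rightarrow> 't
     \<Rightarrow> ('a, 's, 't) subst_str \<Rightarrow> ('a, 's, 't) subst_str" where
  "graft R P x U p = (\<lambda>(\<pi>, f, r).
     (insert (insert x U) \<pi>, f(insert x U := repoint P U x p),
      repoint R (blk ` \<pi>) (blk (insert x U)) r))"

text \<open>Extensionality of \<open>f\<close> turns the restricted case distinction of the chain
  rule into a function update.\<close>

lemma chain_rule_eq_graft:
  assumes "finite V" "\<Union>\<pi> \<subseteq> V" "f \<in> extensional \<pi>"
  shows "chain_rule R P V ((V2, V1), ((\<pi>, f, r), p)) = graft R P (star V) V1 p (\<pi>, f, r)"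
proof -
  have "star V \<notin> \<Union>\<pi>" using assms(1,2) star_notin by blast
  then have "insert (star V) V1 \<notin> \<pi>" by blast
  then show ?thesis
    unfolding chain_rule_def graft_def Let_def
    using assms(3) by (auto simp: repoint_def extensional_def restrict_def fun_eq_iff)
qed

lemma partition_on_insert_disjoint:
  assumes "partition_on V2 \<pi>" "V1 \<inter> V2 = {}" "V1 \<noteq> {}"
  shows "partition_on (V1 \<union> V2) (insert V1 \<pi>)"
  using assms unfolding partition_on_def disjoint_def by auto

text \<open>As \<open>x\<close> lies outside \<open>V2\<close>, the enlarged block is not in
  \<open>\<pi>\<close>. Hence its label is a new point for the set of block labels, and the outer
  structure can be renamed to it.\<close>

lemma graft_in:
  assumes R: "is_species R" and P: "is_species P" and fin: "finite V1" "finite V2"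
    and disj: "V1 \<inter> V2 = {}" "x \<notin> V1" "x \<notin> V2"
    and p: "p \<in> str (deriv P) V1" and t: "t \<in> str (sp_subst (deriv R) P) V2"
  shows "graft R P x V1 p t \<in> str (sp_subst R P) (insert x (V1 \<union> V2))"
proof -
  obtain \<pi> f r where teq: "t = (\<pi>, f, r)" by (cases t)
  have part: "partition_on V2 \<pi>" and f: "f \<in> (\<Pi>\<^sub>E B\<in>\<pi>. str P B)"
    and r: "r \<in> str (deriv R) (blk ` \<pi>)"
    using t unfolding teq in_str_subst by auto
  have finB: "finite \<pi>" "\<And>B. B \<in> \<pi> \<Longrightarrow> finite B"
    using part fin(2) partition_on_finite_block by (auto intro: finite_elements)
  have notin: "insert x V1 \<notin> \<pi>" using part disj by (auto simp: partition_on_def)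
  then have bnotin: "blk (insert x V1) \<notin> blk ` \<pi>" using finB fin by (auto simp: blk_eq_iff)
  have "partition_on (insert x V1 \<union> V2) (insert (insert x V1) \<pi>)"
    by (rule partition_on_insert_disjoint[OF part]) (use disj in auto)
  moreover have "f(insert x V1 := repoint P V1 x p) \<in> (\<Pi>\<^sub>E B\<in>insert (insert x V1) \<pi>. str P B)"
    using f repoint_in[OF P fin(1) disj(2) p] by (auto simp: PiE_iff extensional_def)
  moreover have "repoint R (blk ` \<pi>) (blk (insert x V1)) r \<in> str R (insert (blk (insert x V1)) (blk ` \<pi>))"
    by (rule repoint_in[OF R]) (use finB bnotin r in auto)
  ultimately show ?thesis by (simp add: graft_def teq in_str_subst)
qed

text \<open>Naturality of the chain rule in the set and in the distinguished point at once. It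
  reduces to naturality of renaming, used twice: for the inner structure at the point
  \<open>x\<close>, and for the outer structure at the label of the block that contains
  \<open>x\<close>.\<close>

lemma tr_graft:
  assumes R: "is_species R" and P: "is_species P" and fin: "finite V1" "finite V2"
    and disj: "V1 \<inter> V2 = {}" "x \<notin> V1" "x \<notin> V2"
    and p: "p \<in> str (deriv P) V1" and t: "t \<in> str (sp_subst (deriv R) P) V2"
    and inj: "inj_on \<tau> (insert x (V1 \<union> V2))"
    and \<tau>: "\<And>v. v \<in> V1 \<union> V2 \<Longrightarrow> \<tau> v = \<sigma> v" "\<tau> x = y"
  shows "tr (sp_subst R P) (insert x (V1 \<union> V2)) \<tau> (graft R P x V1 p t) =
    graft R P y (\<sigma> ` V1) (tr (deriv P) V1 \<sigma> p) (tr (sp_subst (deriv R) P) V2 \<sigma> t)"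
proof -
  obtain \<pi> f r where teq: "t = (\<pi>, f, r)" by (cases t)
  have part: "partition_on V2 \<pi>" and f: "f \<in> (\<Pi>\<^sub>E B\<in>\<pi>. str P B)"
    and r: "r \<in> str (deriv R) (blk ` \<pi>)"
    using t unfolding teq in_str_subst by auto
  have finB: "finite \<pi>" "\<And>B. B \<in> \<pi> \<Longrightarrow> finite B" and sub: "\<And>B. B \<in> \<pi> \<Longrightarrow> B \<subseteq> V2"
    using part fin(2) partition_on_finite_block by (auto intro: finite_elements simp: partition_on_def)
  have notin: "insert x V1 \<notin> \<pi>" using part disj by (auto simp: partition_on_def)
  then have bnotin: "blk (insert x V1) \<notin> blk ` \<pi>" using finB fin by (auto simp: blk_eq_iff)
  have part': "partition_on (insert x (V1 \<union> V2)) (insert (insert x V1) \<pi>)"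
    using partition_on_insert_disjoint[OF part, of "insert x V1"] disj by simp
  have inj\<sigma>: "inj_on \<sigma> V2" using inj \<tau> by (auto simp: inj_on_def)
  have im: "\<tau> ` insert x V1 = insert y (\<sigma> ` V1)" using \<tau> by auto
  have imB: "\<tau> ` B = \<sigma> ` B" if "B \<in> \<pi>" for B using sub[OF that] \<tau>(1) by (auto intro!: image_cong)
  have y: "y \<notin> \<sigma> ` V2" using inj \<tau> disj by (force simp: inj_on_def)
  \<comment> \<open>Thus the update of \<open>f'\<close> at the new image block overwrites no value
    at an old one.\<close>
  have newB: "insert y (\<sigma> ` V1) \<notin> (`) \<sigma> ` \<pi>"
  proof
    assume "insert y (\<sigma> ` V1) \<in> (`) \<sigma> ` \<pi>"
    then obtain B where "B \<in> \<pi>" "insert y (\<sigma> ` V1) = \<sigma> ` B" by auto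
    then have "y \<in> \<sigma> ` V2" using sub[of B] by (metis image_mono insertI1 subsetD)
    then show False using y by simp
  qed
  define f' where "f' = (\<lambda>C\<in>(`) \<sigma> ` \<pi>. let B = {v \<in> V2. \<sigma> v \<in> C} in tr P B \<sigma> (f B))"
  define r' where "r' = tr (deriv R) (blk ` \<pi>) (\<lambda>x. blk (\<sigma> ` unblk x)) r"
  have t': "tr (sp_subst (deriv R) P) V2 \<sigma> t = ((`) \<sigma> ` \<pi>, f', r')"
    by (simp add: sp_subst_def teq f'_def r'_def)
  have f': "f' (\<sigma> ` B) = tr P B \<sigma> (f B)" if "B \<in> \<pi>" for B
  proof -
    have "{v \<in> V2. \<sigma> v \<in> \<sigma> ` B} = B" using sub[OF that] inj\<sigma> by (auto simp: inj_on_def)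
    then show ?thesis using that by (simp add: f'_def)
  qed
  show ?thesis
    unfolding t' unfolding graft_def teq prod.case
  proof (rule tr_subst_eqI[OF _ inj part'])
    show "insert (insert y (\<sigma> ` V1)) ((`) \<sigma> ` \<pi>) = (`) \<tau> ` insert (insert x V1) \<pi>"
      using im imB by (auto simp: image_iff)
    show "f'(insert y (\<sigma> ` V1) := repoint P (\<sigma> ` V1) y (tr (deriv P) V1 \<sigma> p)) \<in>
        extensional (insert (insert y (\<sigma> ` V1)) ((`) \<sigma> ` \<pi>))"
      by (auto simp: f'_def extensional_def)
    fix B assume B: "B \<in> insert (insert x V1) \<pi>"
    show "(f'(insert y (\<sigma> ` V1) := repoint P (\<sigma> ` V1) y (tr (deriv P) V1 \<sigma> p))) (\<tau> ` B) =
        tr P B \<tau> ((f(insert x V1 := repoint P V1 x p)) B)"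
    proof (cases "B = insert x V1")
      case True
      have "tr P (insert x V1) \<tau> (repoint P V1 x p) =
          repoint P (\<sigma> ` V1) y (tr (deriv P) V1 \<sigma> p)"
        by (rule tr_repoint_eq[OF P fin(1)])
          (use disj p inj \<tau> in \<open>auto intro: inj_on_subset\<close>)
      then show ?thesis using True im by simp
    next
      case False
      then have B: "B \<in> \<pi>" using B by simp
      have "tr P B \<tau> (f B) = tr P B \<sigma> (f B)"
        by (rule tr_cong[OF P])
          (use B finB f sub[OF B] \<tau> inj in \<open>auto intro: inj_on_subset simp: subset_iff\<close>)
      moreover have "\<sigma> ` B \<noteq> insert y (\<sigma> ` V1)" using newB B by (metis imageI)
      ultimately show ?thesis using B False f'[OF B] imB[OF B] by simp
    qed
  next
    have fv: "finite (insert x (V1 \<union> V2))" using fin by simp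
    \<comment> \<open>Renaming one level up: the point is now the label of the new block, and the
      map is the one induced on block labels.\<close>
    have "tr R (insert (blk (insert x V1)) (blk ` \<pi>)) (\<lambda>z. blk (\<tau> ` unblk z))
        (repoint R (blk ` \<pi>) (blk (insert x V1)) r) =
      repoint R (blk ` (`) \<sigma> ` \<pi>) (blk (insert y (\<sigma> ` V1))) r'"
      unfolding r'_def
    proof (rule tr_repoint_eq[OF R])
      show "inj_on (\<lambda>z. blk (\<tau> ` unblk z)) (insert (blk (insert x V1)) (blk ` \<pi>))"
        using blk_map_inj_on[OF fv inj part'] by simp
      show "blk ` (`) \<sigma> ` \<pi> = (\<lambda>x. blk (\<sigma> ` unblk x)) ` blk ` \<pi>"
        by (rule blk_map_image[OF fin(2) part, symmetric])
    qed (use finB bnotin r imB im fin in auto)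
    then show "repoint R (blk ` (`) \<sigma> ` \<pi>) (blk (insert y (\<sigma> ` V1))) r' =
      tr R (blk ` insert (insert x V1) \<pi>) (\<lambda>z. blk (\<tau> ` unblk z))
        (repoint R (blk ` \<pi>) (blk (insert x V1)) r)" by simp
  qed (use fin in simp)
qed

text \<open>Renaming the new point is transport along \<open>id\<close> updated at one point, so
  \<open>tr_graft\<close> applies with \<open>id\<close> for \<open>\<sigma>\<close>.\<close>

lemma repoint_graft:
  assumes R: "is_species R" and P: "is_species P" and fin: "finite V1" "finite V2"
    and disj: "V1 \<inter> V2 = {}" "x \<notin> V1 \<union> V2"
    and p: "p \<in> str (deriv P) V1" and t: "t \<in> str (sp_subst (deriv R) P) V2"
  shows "repoint (sp_subst R P) (V1 \<union> V2) x (graft R P (star (V1 \<union> V2)) V1 p t) = graft R P x V1 p t"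
proof -
  let ?s = "star (V1 \<union> V2)"
  have s: "?s \<notin> V1 \<union> V2" using fin star_notin by blast
  have "repoint (sp_subst R P) (V1 \<union> V2) x (graft R P ?s V1 p t) =
      graft R P x (id ` V1) (tr (deriv P) V1 id p) (tr (sp_subst (deriv R) P) V2 id t)"
    unfolding repoint_def plus_star_def
  proof (rule tr_graft[OF R P fin disj(1) _ _ p t])
    show "inj_on (id(?s := x)) (insert ?s (V1 \<union> V2))"
      by (rule inj_on_upd) (use s disj in auto)
  qed (use s in auto)
  then show ?thesis
    using tr_subst_ident[OF P is_species_deriv[OF R] fin(2) t]
      tr_ident[OF is_species_deriv[OF P] fin(1) p, of id] by simp
qed

text \<open>The product \<open>\<rho>\<close> of the theorem. The swap is there because
  \<open>chain_rule\<close> expects the inner marked structure as second factor, while the Riordan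
  product has it first.\<close>

definition deriv_prod ::
    "('a, 's) species \<Rightarrow> ('a, ('a, 's, 's) subst_str, 's) mor
     \<Rightarrow> ('a, ('a, 's, ('a, 's, 's) subst_str) prod_str, 's) mor" where
  "deriv_prod P \<eta> = deriv_mor \<eta> \<circ>\<^sub>s chain_rule P P \<circ>\<^sub>s prod_swap"

lemma deriv_prod_eq:
  assumes "finite V" "\<Union>\<pi> \<subseteq> V" "f \<in> extensional \<pi>"
  shows "deriv_prod P \<eta> V ((V1, V2), (m, (\<pi>, f, r))) =
    \<eta> (plus_star V) (graft P P (star V) V1 m (\<pi>, f, r))"
  by (simp add: deriv_prod_def mor_comp_def prod_swap_def deriv_mor_def chain_rule_eq_graft[OF assms])

lemma deriv_prod_eq':
  assumes "finite V" "V2 \<subseteq> V" "t \<in> str (sp_subst R P) V2"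
  shows "deriv_prod P \<eta> V ((V1, V2), (m, t)) = \<eta> (plus_star V) (graft P P (star V) V1 m t)"
proof -
  obtain \<pi> f r where t: "t = (\<pi>, f, r)" by (cases t)
  show ?thesis
    unfolding t by (rule deriv_prod_eq) (use assms in \<open>auto simp: t in_str_subst PiE_iff partition_on_def\<close>)
qed

lemma is_species_X: "is_species sp_X"
  unfolding is_species_def
  by (auto simp: sp_X_def card_image split: if_splits)

lemma in_str_prod:
  "((V1, V2), (m, n)) \<in> str (sp_prod M N) V \<longleftrightarrow>
     V1 \<union> V2 = V \<and> V1 \<inter> V2 = {} \<and> m \<in> str M V1 \<and> n \<in> str N V2"
  by (auto simp: sp_prod_def)

text \<open>A point of the union lies in exactly one block of \<open>\<pi>\<close>, and the label of
  that block lies in exactly one block of \<open>\<kappa>\<close>; so one point of the union already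
  determines \<open>K\<close>.\<close>

lemma Union_unblk_inj_on:
  assumes "finite V" "partition_on V \<pi>" "partition_on (blk ` \<pi>) \<kappa>"
  shows "inj_on (\<lambda>K. \<Union>(unblk ` K)) \<kappa>"
proof (rule inj_onI)
  fix K L assume K: "K \<in> \<kappa>" and L: "L \<in> \<kappa>" and eq: "\<Union>(unblk ` K) = \<Union>(unblk ` L)"
  have "K \<noteq> {}" "K \<subseteq> blk ` \<pi>" "L \<subseteq> blk ` \<pi>"
    using K L assms(3) by (auto simp: partition_on_def)
  then obtain B where B: "B \<in> \<pi>" "blk B \<in> K" by blast
  then have "B \<noteq> {}" using assms(2) by (auto simp: partition_on_def)
  then obtain v where "v \<in> B" by blast
  have "finite B" using partition_on_finite_block assms(1,2) B(1) by blast
  then have "v \<in> \<Union>(unblk ` K)" using B \<open>v \<in> B\<close> by force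
  then obtain y where y: "y \<in> L" "v \<in> unblk y" unfolding eq by blast
  then obtain C where C: "C \<in> \<pi>" "y = blk C" using \<open>L \<subseteq> blk ` \<pi>\<close> by blast
  then have "finite C" using partition_on_finite_block assms(1,2) by blast
  then have "v \<in> C" using y C by simp
  then have "B = C" using \<open>v \<in> B\<close> B(1) C(1) assms(2) by (auto simp: partition_on_def disjoint_def)
  then have "blk B \<in> K \<inter> L" using B C y by simp
  then show "K = L" using K L assms(3) by (auto simp: partition_on_def disjoint_def)
qed

section \<open>The product derived from an operad\<close>

context
  fixes P :: "('a, 's) species"
    and \<eta> :: "('a, ('a, 's, 's) subst_str, 's) mor"
    and e :: "('a, 'a label, 's) mor"
  assumes operad: "operad P \<eta> e"
begin

lemma operad_species: "is_species P"
  and operad_mor_prod: "is_mor (sp_subst P P) P \<eta>"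
  and operad_mor_unit: "is_mor sp_X P e"
  using operad by (simp_all add: operad_def)

lemma operad_assoc:
  assumes "finite V" "z \<in> str (sp_subst (sp_subst P P) P) V"
  shows "\<eta> V (subst_mor mor_id \<eta> V (subst_assoc P V z)) = \<eta> V (subst_mor \<eta> mor_id V z)"
  using operad assms by (simp add: operad_def mor_eq_def mor_comp_def)

lemma operad_lunit:
  assumes "finite V" "z \<in> str (sp_subst sp_X P) V"
  shows "\<eta> V (subst_mor e mor_id V z) = subst_lunit V z"
  using operad assms by (simp add: operad_def mor_eq_def mor_comp_def)

lemma operad_runit:
  assumes "finite V" "z \<in> str (sp_subst P sp_X) V"
  shows "\<eta> V (subst_mor mor_id e V z) = subst_runit P V z"
  using operad assms by (simp add: operad_def mor_eq_def mor_comp_def)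

lemma deriv_prod_in:
  assumes "finite V1" "finite V2" "V1 \<inter> V2 = {}"
    and "m \<in> str (deriv P) V1" "t \<in> str (sp_subst (deriv P) P) V2"
  shows "deriv_prod P \<eta> (V1 \<union> V2) ((V1, V2), (m, t)) \<in> str (deriv P) (V1 \<union> V2)"
proof -
  have "star (V1 \<union> V2) \<notin> V1 \<union> V2" using assms star_notin by blast
  then have "graft P P (star (V1 \<union> V2)) V1 m t \<in> str (sp_subst P P) (plus_star (V1 \<union> V2))"
    unfolding plus_star_def by (intro graft_in operad_species) (use assms in auto)
  then show ?thesis
    using assms by (subst deriv_prod_eq') (auto simp: str_deriv finite_plus_star intro: mor_in[OF operad_mor_prod])
qed

text \<open>Naturality of \<open>\<eta>\<close> lets the product be evaluated at any point outside
  the set. In an iterated product this brings an inner factor, formed with its own new point, to the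
  point dictated by the outer one.\<close>

lemma repoint_deriv_prod:
  assumes "finite V1" "finite V2" "V1 \<inter> V2 = {}" "x \<notin> V1 \<union> V2"
    and "m \<in> str (deriv P) V1" "t \<in> str (sp_subst (deriv P) P) V2"
  shows "repoint P (V1 \<union> V2) x (deriv_prod P \<eta> (V1 \<union> V2) ((V1, V2), (m, t))) =
    \<eta> (insert x (V1 \<union> V2)) (graft P P x V1 m t)"
proof -
  let ?V = "V1 \<union> V2"
  have fin: "finite ?V" using assms by simp
  have s: "star ?V \<notin> ?V" using star_notin[OF fin] .
  have "graft P P (star ?V) V1 m t \<in> str (sp_subst P P) (plus_star ?V)"
    unfolding plus_star_def by (intro graft_in operad_species) (use assms s in auto)
  then have "repoint P ?V x (\<eta> (plus_star ?V) (graft P P (star ?V) V1 m t)) =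
      \<eta> (insert x ?V) (repoint (sp_subst P P) ?V x (graft P P (star ?V) V1 m t))"
    unfolding repoint_def
    using inj_on_star_upd[OF fin, of id x] image_star_upd[OF fin, of id x] assms(4) fin
    by (intro mor_natural[OF operad_mor_prod]) (simp_all add: finite_plus_star)
  then show ?thesis
    using assms by (simp add: deriv_prod_eq' repoint_graft operad_species)
qed

text \<open>With \<open>\<sigma>\<close> extended to the new points, this is naturality of grafting
  followed by naturality of \<open>\<eta>\<close>.\<close>

lemma is_mor_deriv_prod:
  "is_mor (sp_prod (deriv P) (sp_subst (deriv P) P)) (deriv P) (deriv_prod P \<eta>)"
  unfolding is_mor_def
proof (intro conjI allI impI ballI)
  fix V :: "'a label set" and s
  assume "finite V" and s: "s \<in> str (sp_prod (deriv P) (sp_subst (deriv P) P)) V"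
  obtain V1 V2 m t where "s = ((V1, V2), (m, t))" by (metis prod.exhaust)
  then show "deriv_prod P \<eta> V s \<in> str (deriv P) V"
    using s \<open>finite V\<close> deriv_prod_in[of V1 V2 m t] by (auto simp: in_str_prod)
next
  fix V :: "'a label set" and \<sigma> :: "'a label \<Rightarrow> 'a label" and s
  assume fin: "finite V" and inj: "inj_on \<sigma> V"
    and s: "s \<in> str (sp_prod (deriv P) (sp_subst (deriv P) P)) V"
  obtain V1 V2 m t where seq: "s = ((V1, V2), (m, t))" by (metis prod.exhaust)
  have V: "V = V1 \<union> V2" and disj: "V1 \<inter> V2 = {}" and m: "m \<in> str (deriv P) V1"
    and t: "t \<in> str (sp_subst (deriv P) P) V2"
    using s by (auto simp: seq in_str_prod)
  have fins: "finite V1" "finite V2" using fin V by auto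
  let ?\<sigma> = "\<sigma>(star V := star (\<sigma> ` V))"
  have sV: "star V \<notin> V" "star (\<sigma> ` V) \<notin> \<sigma> ` V" using fin by (auto intro!: star_notin simp del: image_iff)
  have inj': "inj_on ?\<sigma> (plus_star V)" by (rule inj_on_star_upd[OF fin inj sV(2)])
  have im: "?\<sigma> ` plus_star V = plus_star (\<sigma> ` V)" using image_star_upd[OF fin] by (simp add: plus_star_def)
  have graft: "graft P P (star V) V1 m t \<in> str (sp_subst P P) (plus_star V)"
    unfolding plus_star_def V by (intro graft_in operad_species) (use fins disj sV m t V in auto)
  obtain \<pi> f r where teq: "t = (\<pi>, f, r)" by (cases t)
  let ?t = "tr (sp_subst (deriv P) P) V2 \<sigma> t"
  have "deriv_prod P \<eta> (\<sigma> ` V) ((\<sigma> ` V1, \<sigma> ` V2), (tr (deriv P) V1 \<sigma> m, ?t)) =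
      \<eta> (plus_star (\<sigma> ` V)) (graft P P (star (\<sigma> ` V)) (\<sigma> ` V1) (tr (deriv P) V1 \<sigma> m) ?t)"
  proof -
    have "\<Union>((`) \<sigma> ` \<pi>) \<subseteq> \<sigma> ` V" using t by (auto simp: teq in_str_subst V partition_on_def)
    then show ?thesis
      unfolding teq sp_subst_def using fin by (simp add: deriv_prod_eq)
  qed
  also have "graft P P (star (\<sigma> ` V)) (\<sigma> ` V1) (tr (deriv P) V1 \<sigma> m) ?t =
      tr (sp_subst P P) (plus_star V) ?\<sigma> (graft P P (star V) V1 m t)"
    unfolding plus_star_def V
    by (rule tr_graft[OF operad_species operad_species fins disj _ _ m t, symmetric])
      (use sV inj' in \<open>auto simp: V plus_star_def simp del: fun_upd_apply\<close>, auto)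
  also have "\<eta> (plus_star (\<sigma> ` V)) \<dots> = tr P (plus_star V) ?\<sigma> (\<eta> (plus_star V) (graft P P (star V) V1 m t))"
    by (rule mor_natural[OF operad_mor_prod _ inj' graft im, symmetric]) (use fin in \<open>simp add: finite_plus_star\<close>)
  also have "\<dots> = tr (deriv P) V \<sigma> (deriv_prod P \<eta> V s)"
    using fin V t by (simp add: tr_deriv seq deriv_prod_eq')
  finally show "deriv_prod P \<eta> (\<sigma> ` V) (tr (sp_prod (deriv P) (sp_subst (deriv P) P)) V \<sigma> s) =
      tr (deriv P) V \<sigma> (deriv_prod P \<eta> V s)"
    by (simp add: sp_prod_def seq)
qed

section \<open>The derived unit, and the unit and associativity axioms on elements\<close>

lemma operad_unit_in: "e {x} x \<in> str P {x}"
  by (rule mor_in[OF operad_mor_unit]) (auto simp: sp_X_def)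

lemma tr_operad_unit: "tr P {x} \<sigma> (e {x} x) = e {\<sigma> x} (\<sigma> x)"
  by (subst mor_natural[OF operad_mor_unit]) (auto simp: sp_X_def)

lemma plus_star_empty: "plus_star {} = {star {}}"
  by (simp add: plus_star_def)

lemma repoint_operad_unit: "repoint P {} x (e {star {}} (star {})) = e {x} x"
  by (simp add: repoint_def plus_star_empty tr_operad_unit)

lemma deriv_unit_in: "e {star {}} (star {}) \<in> str (deriv P) {}"
  by (simp add: str_deriv plus_star_empty operad_unit_in)

lemma deriv_unit_eq: "(deriv_mor e \<circ>\<^sub>s one_deriv_X) {} z = e {star {}} (star {})"
  by (simp add: mor_comp_def deriv_mor_def one_deriv_X_def plus_star_empty)

lemma is_mor_deriv_unit: "is_mor sp_one (deriv P) (deriv_mor e \<circ>\<^sub>s one_deriv_X)"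
  unfolding is_mor_def
proof (intro conjI allI impI ballI)
  fix U :: "'a label set" and s assume "s \<in> str sp_one U"
  then have "U = {}" by (auto simp: sp_one_def split: if_splits)
  then show "(deriv_mor e \<circ>\<^sub>s one_deriv_X) U s \<in> str (deriv P) U"
    by (simp add: deriv_unit_eq deriv_unit_in)
next
  fix U :: "'a label set" and \<sigma> :: "'a label \<Rightarrow> 'a label" and s assume "s \<in> str sp_one U"
  then have "U = {}" by (auto simp: sp_one_def split: if_splits)
  then show "(deriv_mor e \<circ>\<^sub>s one_deriv_X) (\<sigma> ` U) (tr sp_one U \<sigma> s) =
      tr (deriv P) U \<sigma> ((deriv_mor e \<circ>\<^sub>s one_deriv_X) U s)"
    by (simp add: deriv_unit_eq tr_deriv plus_star_empty tr_operad_unit)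
qed

text \<open>The left unit of the Riordan category involves substitution of \<open>X\<close>, so the
  right unit law of the operad is what applies. It is used on the whole of
  \<open>plus_star V\<close>, whose new point forms a singleton block of its own.\<close>

lemma deriv_prod_lunit:
  assumes fin: "finite V" and t: "t \<in> str (sp_subst (deriv P) sp_X) V"
  shows "deriv_prod P \<eta> V (({}, V), (e {star {}} (star {}), subst_mor mor_id e V t)) =
    subst_runit (deriv P) V t"
proof -
  obtain \<pi> f a where teq: "t = (\<pi>, f, a)" by (cases t)
  have part: "partition_on V \<pi>" and f: "f \<in> (\<Pi>\<^sub>E B\<in>\<pi>. str sp_X B)"
    and a: "a \<in> str (deriv P) (blk ` \<pi>)"
    using t unfolding teq in_str_subst by auto
  have finB: "finite \<pi>" "\<And>B. B \<in> \<pi> \<Longrightarrow> finite B"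
    using part fin partition_on_finite_block by (auto intro: finite_elements)
  let ?s = "star V"
  have s: "?s \<notin> V" using fin by (rule star_notin)
  have single: "B = {f B}" if "B \<in> \<pi>" for B
  proof -
    have "f B \<in> str sp_X B" using f that by auto
    then have "card B = 1" "f B \<in> B" by (auto simp: sp_X_def split: if_splits)
    then show ?thesis by (auto simp: card_1_singleton_iff)
  qed
  have s\<pi>: "{?s} \<notin> \<pi>" using part s by (auto simp: partition_on_def)
  have f_image: "f ` \<pi> = V"
  proof -
    have "V = \<Union>\<pi>" using part by (simp add: partition_on_def)
    also have "\<dots> = (\<Union>B\<in>\<pi>. {f B})" using single by auto
    finally show ?thesis by auto
  qed
  \<comment> \<open>Here \<open>star {}\<close> is the only structure of the derivative of
    \<open>X\<close> on the empty set; grafting it adds the singleton block of the new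
    point.\<close>
  define z where "z = graft P sp_X ?s {} (star {}) t"
  have X: "repoint sp_X {} ?s (star {}) = ?s" by (simp add: repoint_def sp_X_def)
  have z: "z = (insert {?s} \<pi>, f({?s} := ?s), repoint P (blk ` \<pi>) (blk {?s}) a)"
    by (simp add: z_def graft_def teq X)
  have "z \<in> str (sp_subst P sp_X) (insert ?s ({} \<union> V))"
    unfolding z_def
    by (intro graft_in operad_species is_species_X t) (use fin s in \<open>auto simp: str_deriv plus_star_empty sp_X_def\<close>)
  then have zin: "z \<in> str (sp_subst P sp_X) (plus_star V)" by (simp add: plus_star_def)
  have "deriv_prod P \<eta> V (({}, V), (e {star {}} (star {}), subst_mor mor_id e V t)) =
      \<eta> (plus_star V) (graft P P ?s {} (e {star {}} (star {})) (subst_mor mor_id e V t))"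
    using part fin by (simp add: subst_mor_def teq deriv_prod_eq partition_on_def)
  also have "graft P P ?s {} (e {star {}} (star {})) (subst_mor mor_id e V t) =
      subst_mor mor_id e (plus_star V) z"
    using s\<pi> by (auto simp: z subst_mor_def teq graft_def mor_id_def repoint_operad_unit restrict_def fun_eq_iff)
  also have "\<eta> (plus_star V) \<dots> = subst_runit P (plus_star V) z"
    by (rule operad_runit[OF _ zin]) (use fin in \<open>simp add: finite_plus_star\<close>)
  also have "\<dots> = tr P (insert (blk {?s}) (blk ` \<pi>)) (\<lambda>x. (f({?s} := ?s)) (unblk x))
      (repoint P (blk ` \<pi>) (blk {?s}) a)"
    by (simp add: subst_runit_def z)
  \<comment> \<open>The updated \<open>f\<close> maps the labels of the singleton blocks bijectively
    to \<open>plus_star V\<close> and the label of the new block to \<open>?s\<close>, so it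
    commutes with renaming.\<close>
  also have "\<dots> = repoint P V ?s (tr (deriv P) (blk ` \<pi>) (\<lambda>x. f (unblk x)) a)"
  proof (rule tr_repoint_eq[OF operad_species])
    show "inj_on (\<lambda>x. (f({?s} := ?s)) (unblk x)) (insert (blk {?s}) (blk ` \<pi>))"
    \<comment> \<open>The inverse sends a point to the label of its singleton.\<close>
    proof (rule inj_on_inverseI)
      fix x assume "x \<in> insert (blk {?s}) (blk ` \<pi>)"
      then obtain B where B: "B \<in> insert {?s} \<pi>" "x = blk B" by blast
      then have "unblk x = B" using finB by auto
      moreover have "B = {(f({?s} := ?s)) B}" using B single by (cases "B = {?s}") auto
      ultimately show "blk {(f({?s} := ?s)) (unblk x)} = x" using B by simp
    qed
    have "(\<lambda>x. f (unblk x)) ` blk ` \<pi> = f ` \<pi>"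
      unfolding image_image using finB by (intro image_cong) auto
    then show "V = (\<lambda>x. f (unblk x)) ` blk ` \<pi>" using f_image by simp
    show "blk {?s} \<notin> blk ` \<pi>" using s\<pi> finB by (auto simp: blk_eq_iff)
    fix u assume "u \<in> blk ` \<pi>"
    then show "(f({?s} := ?s)) (unblk u) = f (unblk u)" using s\<pi> finB by auto
  qed (use finB a in auto)
  also have "\<dots> = tr (deriv P) (blk ` \<pi>) (\<lambda>x. f (unblk x)) a"
  proof (rule repoint_star[OF operad_species fin], rule tr_in[OF is_species_deriv[OF operad_species]])
    show "inj_on (\<lambda>x. f (unblk x)) (blk ` \<pi>)"
    proof (rule inj_on_inverseI)
      fix x assume "x \<in> blk ` \<pi>"
      then show "blk {f (unblk x)} = x" using single finB by auto
    qed
    have "(\<lambda>x. f (unblk x)) ` blk ` \<pi> = f ` \<pi>"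
      unfolding image_image using finB by (intro image_cong) auto
    then show "(\<lambda>x. f (unblk x)) ` blk ` \<pi> = V" using f_image by simp
  qed (use finB a in auto)
  finally show ?thesis by (simp add: subst_runit_def teq)
qed

text \<open>With an empty second part, grafting yields the partition of \<open>plus_star V\<close>
  into one block, and the left unit law of the operad applies. The function
  \<open>\<lambda>_. undefined\<close> is the only extensional family on the empty
  partition.\<close>

lemma deriv_prod_runit:
  assumes fin: "finite V" and m: "m \<in> str (deriv P) V"
  shows "deriv_prod P \<eta> V ((V, {}), (m, ({}, \<lambda>_. undefined, e {star {}} (star {})))) = m"
proof -
  \<comment> \<open>The \<open>X\<close>-structure on a one-element set of blocks can only be the
    label of that block.\<close>
  let ?z = "({plus_star V}, \<lambda>B\<in>{plus_star V}. m, blk (plus_star V))"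
  have "deriv_prod P \<eta> V ((V, {}), (m, ({}, \<lambda>_. undefined, e {star {}} (star {})))) =
      \<eta> (plus_star V) (graft P P (star V) V m ({}, \<lambda>_. undefined, e {star {}} (star {})))"
    by (rule deriv_prod_eq) (use fin in \<open>auto simp: extensional_def\<close>)
  also have "graft P P (star V) V m ({}, \<lambda>_. undefined, e {star {}} (star {})) =
      subst_mor e mor_id (plus_star V) ?z"
    using fin m
    by (auto simp: graft_def subst_mor_def repoint_operad_unit repoint_star operad_species
        mor_id_def plus_star_def)
  also have "\<eta> (plus_star V) \<dots> = subst_lunit (plus_star V) ?z"
  proof (rule operad_lunit)
    show "?z \<in> str (sp_subst sp_X P) (plus_star V)"
      using m by (auto simp: in_str_subst str_deriv sp_X_def plus_star_def intro!: partition_on_space)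
  qed (use fin in \<open>simp add: finite_plus_star\<close>)
  finally show ?thesis by (simp add: subst_lunit_def)
qed

text \<open>Three new points have to be aligned: that of \<open>m\<close> becomes
  \<open>star V\<close>, that of \<open>a\<close> the label of the block \<open>B0\<close>
  containing \<open>star V\<close>, and that of \<open>b\<close> the label of the block
  \<open>L0\<close> containing the label of \<open>B0\<close>. The resulting structure
  \<open>z\<close> gives the left side when its partitions are reassociated first, and the right
  side when \<open>\<eta>\<close> is first applied to the two outer levels.\<close>

lemma deriv_prod_assoc:
  assumes fin: "finite V" and V: "V = V1 \<union> W" and disj: "V1 \<inter> W = {}"
    and m: "m \<in> str (deriv P) V1"
    and part: "partition_on W \<pi>" and f: "f \<in> (\<Pi>\<^sub>E B\<in>\<pi>. str P B)"
    and K: "K1 \<union> K2 = blk ` \<pi>" "K1 \<inter> K2 = {}"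
    and a: "a \<in> str (deriv P) K1" and t: "(\<kappa>, g, b) \<in> str (sp_subst (deriv P) P) K2"
    and \<pi>1: "\<pi>1 = unblk ` K1" and \<pi>2: "\<pi>2 = unblk ` K2"
  shows "deriv_prod P \<eta> V ((V1 \<union> \<Union>\<pi>1, \<Union>\<pi>2),
      (deriv_prod P \<eta> (V1 \<union> \<Union>\<pi>1) ((V1, \<Union>\<pi>1), (m, (\<pi>1, restrict f \<pi>1, a))),
       subst_mor mor_id \<eta> (\<Union>\<pi>2)
         (subst_assoc (deriv P) (\<Union>\<pi>2) (\<pi>2, restrict f \<pi>2, (\<kappa>, g, b))))) =
    deriv_prod P \<eta> V ((V1, W),
      (m, (\<pi>, f, deriv_prod P \<eta> (blk ` \<pi>) ((K1, K2), (a, (\<kappa>, g, b))))))"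
proof -
  let ?s = "star V"
  have s: "?s \<notin> V" using fin by (rule star_notin)
  have finW: "finite V1" "finite W" using fin V by auto
  have finB: "finite \<pi>" "\<And>B. B \<in> \<pi> \<Longrightarrow> finite B" and UW: "\<Union>\<pi> = W" and ne: "{} \<notin> \<pi>"
    using part finW partition_on_finite_block
    by (auto intro: finite_elements simp: partition_on_def)
  have dis\<pi>: "B = C" if "B \<in> \<pi>" "C \<in> \<pi>" "v \<in> B" "v \<in> C" for B C v
    using part that by (auto simp: partition_on_def disjoint_def)
  have finK: "finite K1" "finite K2" using K(1) finB(1) by (metis finite_Un finite_imageI)+
  have \<pi>12: "\<pi>1 \<union> \<pi>2 = \<pi>"
    unfolding \<pi>1 \<pi>2 image_Un[symmetric] K(1) by (rule unblk_blk_image) (rule finB)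
  have blk_unblk: "blk (unblk x) = x" if "x \<in> blk ` \<pi>" for x
    using that finB by auto
  have blk_image: "blk ` unblk ` L = L" if "L \<subseteq> blk ` \<pi>" for L
    using that blk_unblk by (force simp: image_iff)
  have K1: "blk ` \<pi>1 = K1" and K2: "blk ` \<pi>2 = K2"
    using K(1) unfolding \<pi>1 \<pi>2 by (auto intro!: blk_image)
  have dis12: "\<pi>1 \<inter> \<pi>2 = {}" using K1 K2 K(2) by blast
  have disU: "\<Union>\<pi>1 \<inter> \<Union>\<pi>2 = {}" using dis12 \<pi>12 dis\<pi> by blast
  have part\<kappa>: "partition_on K2 \<kappa>" and g: "g \<in> (\<Pi>\<^sub>E B\<in>\<kappa>. str P B)"
    and b: "b \<in> str (deriv P) (blk ` \<kappa>)"
    using t unfolding in_str_subst by auto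
  have fin\<kappa>: "finite \<kappa>" "\<And>L. L \<in> \<kappa> \<Longrightarrow> finite L"
    using part\<kappa> finK partition_on_finite_block by (auto intro: finite_elements)
  have sub\<kappa>: "L \<subseteq> K2" if "L \<in> \<kappa>" for L using part\<kappa> that by (auto simp: partition_on_def)
  \<comment> \<open>The coarsening map: a set of block labels goes to the union of the blocks they
    name.\<close>
  define q :: "'a label set \<Rightarrow> 'a label set" where "q L = \<Union>(unblk ` L)" for L
  define \<pi>' where "\<pi>' = q ` \<kappa>"
  have q_sub: "q L \<subseteq> \<Union>\<pi>2" if "L \<in> \<kappa>" for L
    using sub\<kappa>[OF that] unfolding q_def \<pi>2 by blast
  \<comment> \<open>\<open>U\<close> carries the first factor after reassociation.
    \<open>B0\<close>, \<open>L0\<close> and \<open>D0\<close> are the blocks through which the path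
    to \<open>star V\<close> runs: in the fine partition, in the partition of its labels, and in the
    coarse partition.\<close>
  define U where "U = V1 \<union> \<Union>\<pi>1"
  define B0 where "B0 = insert ?s V1"
  define D0 where "D0 = insert ?s U"
  define L0 where "L0 = insert (blk B0) K1"
  define m0 where "m0 = repoint P V1 ?s m"
  define a0 where "a0 = repoint P K1 (blk B0) a"
  have finB0: "finite B0" using finW by (simp add: B0_def)
  have B0\<pi>: "B0 \<notin> \<pi>" using s UW V unfolding B0_def by blast
  have bB0: "blk B0 \<notin> blk ` \<pi>" using B0\<pi> finB finB0 by (auto simp: blk_eq_iff)
  have L0\<kappa>: "L0 \<notin> \<kappa>" using sub\<kappa>[of L0] bB0 K(1) unfolding L0_def by blast
  have subV: "\<Union>\<pi>1 \<subseteq> V" "\<Union>\<pi>2 \<subseteq> V" "U \<subseteq> V" using \<pi>12 UW V unfolding U_def by auto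
  have q_subV: "\<And>L v. L \<in> \<kappa> \<Longrightarrow> v \<in> q L \<Longrightarrow> v \<in> V" using q_sub subV(2) by blast
  have finUU: "finite (\<Union>\<pi>1)" "finite U" using finite_subset[OF _ fin] subV by auto
  have disU2: "D0 \<inter> \<Union>\<pi>2 = {}"
    using disU s subV disj UW \<pi>12 unfolding D0_def U_def by blast
  define F where "F D = {B \<in> \<pi>2. B \<subseteq> D}" for D
  define h where "h = (\<lambda>D\<in>\<pi>'. \<eta> D (F D, restrict f (F D), g (blk ` F D)))"
  define b' where "b' = tr (deriv P) (blk ` \<kappa>) (\<lambda>x. blk (q (unblk x))) b"
  \<comment> \<open>Both graftings are carried out here: \<open>m\<close> is put into
    \<open>B0\<close>, and \<open>a\<close> is grafted onto \<open>(\<kappa>, g, b)\<close> at the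
    label of \<open>B0\<close>.\<close>
  define z where "z = (insert B0 \<pi>, f(B0 := m0), graft P P (blk B0) K1 a (\<kappa>, g, b))"
  have z_eq: "graft P P (blk B0) K1 a (\<kappa>, g, b) =
      (insert L0 \<kappa>, g(L0 := a0), repoint P (blk ` \<kappa>) (blk L0) b)"
    by (simp add: graft_def L0_def a0_def)
  have partB: "partition_on (plus_star V) (insert B0 \<pi>)"
    using partition_on_insert_disjoint[OF part, of B0] disj s V
    by (auto simp: B0_def plus_star_def)
  have bin: "blk B0 \<notin> K1" "blk B0 \<notin> K2" using bB0 K(1) by auto
  have "graft P P (blk B0) K1 a (\<kappa>, g, b) \<in> str (sp_subst P P) (insert (blk B0) (K1 \<union> K2))"
    by (rule graft_in[OF operad_species operad_species finK K(2) bin a t])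
  moreover have "m0 \<in> str P B0"
    unfolding m0_def B0_def by (rule repoint_in[OF operad_species finW(1) _ m]) (use s V in auto)
  ultimately have zin: "z \<in> str (sp_subst (sp_subst P P) P) (plus_star V)"
    unfolding z_def in_str_subst using partB f by (auto simp: K(1) PiE_iff extensional_def)
  then have part\<kappa>': "partition_on (blk ` insert B0 \<pi>) (insert L0 \<kappa>)"
    by (simp add: z_def in_str_subst z_eq)
  have finV': "finite (plus_star V)" using fin by (rule finite_plus_star)
  have t1: "(\<pi>1, restrict f \<pi>1, a) \<in> str (sp_subst (deriv P) P) (\<Union>\<pi>1)"
    unfolding in_str_subst K1 using a f \<pi>12 part
    by (auto simp: partition_on_def disjoint_def PiE_iff)
  have q0: "q L0 = D0"
    using finB0 by (auto simp: q_def L0_def D0_def U_def B0_def \<pi>1)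
  have notsub: "\<not> B \<subseteq> D" if "B \<in> \<pi>" "B \<subseteq> E" "D \<inter> E = {}" for B D E
  proof
    assume "B \<subseteq> D"
    then have "B \<subseteq> D \<inter> E" using that(2) by simp
    then show False using that ne by simp
  qed
  \<comment> \<open>\<open>G\<close> collects the fine blocks inside a coarse block of
    \<open>z\<close>, and \<open>F\<close> does so for the part away from the new point. They agree
    on every coarse block except \<open>D0\<close>, which consists of \<open>B0\<close> and the
    blocks in \<open>\<pi>1\<close>.\<close>
  define G where "G D = {B \<in> insert B0 \<pi>. B \<subseteq> D}" for D
  have GD0: "G D0 = insert B0 \<pi>1"
    unfolding G_def
  proof (intro equalityI subsetI)
    fix B assume B: "B \<in> {B \<in> insert B0 \<pi>. B \<subseteq> D0}"
    have "B \<notin> \<pi>2" using notsub[of B "\<Union>\<pi>2" D0] disU2 B \<pi>12 by auto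
    then show "B \<in> insert B0 \<pi>1" using B \<pi>12 by auto
  next
    fix B assume "B \<in> insert B0 \<pi>1"
    then show "B \<in> {B \<in> insert B0 \<pi>. B \<subseteq> D0}"
      using \<pi>12 by (auto simp: D0_def B0_def U_def)
  qed
  have GF: "G (q L) = F (q L)" if L: "L \<in> \<kappa>" for L
    unfolding G_def
  proof (intro equalityI subsetI)
    fix B assume B: "B \<in> {B \<in> insert B0 \<pi>. B \<subseteq> q L}"
    then have sub: "B \<subseteq> \<Union>\<pi>2" using q_sub[OF L] by auto
    have "B \<noteq> B0" using sub subV(2) s unfolding B0_def by auto
    moreover have "B \<notin> \<pi>1" using notsub[of B "\<Union>\<pi>2" "\<Union>\<pi>1"] sub disU \<pi>12 by auto
    ultimately show "B \<in> F (q L)" using B \<pi>12 by (auto simp: F_def)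
  next
    fix B assume "B \<in> F (q L)"
    then show "B \<in> {B \<in> insert B0 \<pi>. B \<subseteq> q L}" using \<pi>12 by (auto simp: F_def)
  qed

  \<comment> \<open>The left side: the second factor is reassociated and \<open>\<eta>\<close> is
    evaluated in each coarse block.\<close>
  have "subst_mor mor_id \<eta> (\<Union>\<pi>2)
      (subst_assoc (deriv P) (\<Union>\<pi>2) (\<pi>2, restrict f \<pi>2, (\<kappa>, g, b))) = (\<pi>', h, b')"
  proof -
    have "restrict (restrict f \<pi>2) (F D) = restrict f (F D)" for D
      by (auto simp: F_def restrict_def fun_eq_iff)
    then show ?thesis
      by (auto simp: subst_mor_def subst_assoc_def mor_id_def h_def b'_def \<pi>'_def q_def F_def
          Let_def restrict_def fun_eq_iff)
  qed
  moreover have "deriv_prod P \<eta> V ((U, \<Union>\<pi>2), (n, (\<pi>', h, b'))) =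
      \<eta> (plus_star V) (graft P P ?s U n (\<pi>', h, b'))" for n
    by (rule deriv_prod_eq[OF fin]) (use q_subV in \<open>auto simp: \<pi>'_def h_def\<close>)
  ultimately have "deriv_prod P \<eta> V ((U, \<Union>\<pi>2),
      (deriv_prod P \<eta> U ((V1, \<Union>\<pi>1), (m, (\<pi>1, restrict f \<pi>1, a))),
       subst_mor mor_id \<eta> (\<Union>\<pi>2)
         (subst_assoc (deriv P) (\<Union>\<pi>2) (\<pi>2, restrict f \<pi>2, (\<kappa>, g, b))))) =
    \<eta> (plus_star V) (graft P P ?s U
      (deriv_prod P \<eta> U ((V1, \<Union>\<pi>1), (m, (\<pi>1, restrict f \<pi>1, a)))) (\<pi>', h, b'))"
    by simp
  \<comment> \<open>Grafting renames the new point of the inner product from \<open>star U\<close>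
    to \<open>star V\<close>; that product thereby becomes \<open>\<eta>\<close> evaluated on
    \<open>D0\<close>.\<close>
  also have "graft P P ?s U
      (deriv_prod P \<eta> U ((V1, \<Union>\<pi>1), (m, (\<pi>1, restrict f \<pi>1, a)))) (\<pi>', h, b') =
    (insert D0 \<pi>', h(D0 := \<eta> D0 (graft P P ?s V1 m (\<pi>1, restrict f \<pi>1, a))),
      repoint P (blk ` \<pi>') (blk D0) b')"
  proof -
    have "V1 \<inter> \<Union>\<pi>1 = {}" "?s \<notin> V1 \<union> \<Union>\<pi>1"
      using disj UW \<pi>12 s subV unfolding U_def by blast+
    then show ?thesis
      using repoint_deriv_prod[OF finW(1) finUU(1) _ _ m t1] by (simp add: graft_def D0_def U_def)
  qed
  also have "\<dots> = subst_mor mor_id \<eta> (plus_star V) (subst_assoc P (plus_star V) z)"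
  proof -
    have graft_eq: "graft P P ?s V1 m (\<pi>1, restrict f \<pi>1, a) =
        (insert B0 \<pi>1, restrict (f(B0 := m0)) (insert B0 \<pi>1), (g(L0 := a0)) (blk ` insert B0 \<pi>1))"
      using B0\<pi> \<pi>12 by (auto simp: graft_def B0_def m0_def a0_def K1 L0_def fun_eq_iff restrict_def)
    \<comment> \<open>Away from the new point the updates are invisible: \<open>B0\<close> is not in
      \<open>F D\<close>, and the labels of \<open>F D\<close> do not form \<open>L0\<close>, since
      \<open>L0\<close> contains the label of \<open>B0\<close>.\<close>
    have h_eq: "h D = \<eta> D (F D, restrict (f(B0 := m0)) (F D), (g(L0 := a0)) (blk ` F D))" if "D \<in> \<pi>'" for D
    proof -
      have "B0 \<notin> F D" using B0\<pi> \<pi>12 by (auto simp: F_def)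
      moreover have "blk ` F D \<noteq> L0" using bB0 \<pi>12 unfolding F_def L0_def by blast
      ultimately show ?thesis
        using that by (auto simp: h_def restrict_def fun_eq_iff intro!: arg_cong[where f = "\<eta> D"])
    qed
    \<comment> \<open>Working with the partition of all of \<open>plus_star V\<close> covers
      \<open>L0\<close> together with the members of \<open>\<kappa>\<close>.\<close>
    have "inj_on q (insert L0 \<kappa>)"
      unfolding q_def by (rule Union_unblk_inj_on[OF finV' partB part\<kappa>'])
    have fin_q: "finite (q L)" if "L \<in> insert L0 \<kappa>" for L
    proof -
      have "q L \<subseteq> plus_star V"
        using that q0 q_subV subV unfolding plus_star_def D0_def by auto
      then show ?thesis using finV' finite_subset by blast
    qed
    have finL: "finite L" if "L \<in> insert L0 \<kappa>" for L
      using that fin\<kappa> finK by (auto simp: L0_def)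
    \<comment> \<open>The outer structure \<open>b\<close> is renamed to the label of
      \<open>L0\<close> and then coarsened, or coarsened and then renamed to the label of
      \<open>D0\<close>; these agree because \<open>q\<close> sends \<open>L0\<close> to
      \<open>D0\<close>.\<close>
    have tr_eq: "tr P (insert (blk L0) (blk ` \<kappa>)) (\<lambda>x. blk (q (unblk x))) (repoint P (blk ` \<kappa>) (blk L0) b) =
        repoint P (blk ` \<pi>') (blk D0) b'"
      unfolding b'_def
    proof (rule tr_repoint_eq[OF operad_species])
      show "inj_on (\<lambda>x. blk (q (unblk x))) (insert (blk L0) (blk ` \<kappa>))"
      proof (rule inj_onI)
        fix x y assume "x \<in> insert (blk L0) (blk ` \<kappa>)" "y \<in> insert (blk L0) (blk ` \<kappa>)"
          and eq: "blk (q (unblk x)) = blk (q (unblk y))"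
        then obtain L M where LM: "L \<in> insert L0 \<kappa>" "M \<in> insert L0 \<kappa>" "x = blk L" "y = blk M"
          by blast
        then have "q L = q M" using eq finL fin_q by (simp add: blk_eq_iff)
        then show "x = y" using LM \<open>inj_on q (insert L0 \<kappa>)\<close> by (auto dest: inj_onD)
      qed
      show "blk ` \<pi>' = (\<lambda>x. blk (q (unblk x))) ` blk ` \<kappa>"
        unfolding \<pi>'_def image_image using fin\<kappa> by (intro image_cong) auto
      show "blk L0 \<notin> blk ` \<kappa>"
      proof
        assume "blk L0 \<in> blk ` \<kappa>"
        then obtain L where "L \<in> \<kappa>" "blk L0 = blk L" by blast
        then have "L0 = L" using finL by (simp add: blk_eq_iff)
        then show False using \<open>L \<in> \<kappa>\<close> L0\<kappa> by simp
      qed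
      show "blk (q (unblk (blk L0))) = blk D0" using finL[of L0] q0 by simp
    qed (use fin\<kappa> b in auto)
    have "subst_mor mor_id \<eta> (plus_star V) (subst_assoc P (plus_star V) z) =
      (insert D0 \<pi>', \<lambda>D\<in>insert D0 \<pi>'. \<eta> D (G D, restrict (f(B0 := m0)) (G D), (g(L0 := a0)) (blk ` G D)),
       tr P (insert (blk L0) (blk ` \<kappa>)) (\<lambda>x. blk (q (unblk x))) (repoint P (blk ` \<kappa>) (blk L0) b))"
      unfolding z_def z_eq subst_assoc_def subst_mor_def prod.case Let_def mor_id_def
        q_def[symmetric] G_def[symmetric] image_insert q0 \<pi>'_def[symmetric]
      by (simp cong: restrict_cong)
    moreover have "(\<lambda>D\<in>insert D0 \<pi>'. \<eta> D (G D, restrict (f(B0 := m0)) (G D), (g(L0 := a0)) (blk ` G D))) =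
      h(D0 := \<eta> D0 (graft P P ?s V1 m (\<pi>1, restrict f \<pi>1, a)))" (is "?l = ?r")
    proof
      fix D
      consider "D = D0" | "D \<noteq> D0" "D \<in> \<pi>'" | "D \<notin> insert D0 \<pi>'" by blast
      then show "?l D = ?r D"
      proof cases
        case 1
        then show ?thesis by (simp add: graft_eq GD0)
      next
        case 2
        then have "G D = F D" using GF by (auto simp: \<pi>'_def)
        then show ?thesis using 2 h_eq by simp
      next
        case 3
        then show ?thesis by (auto simp: h_def)
      qed
    qed
    ultimately show ?thesis using tr_eq by simp
  qed
  also have "\<eta> (plus_star V) \<dots> = \<eta> (plus_star V) (subst_mor \<eta> mor_id (plus_star V) z)"
    by (rule operad_assoc[OF finV' zin])
  \<comment> \<open>The right side: its inner product lives on block labels, and grafting renames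
    its new point to the label of \<open>B0\<close>.\<close>
  also have "subst_mor \<eta> mor_id (plus_star V) z =
      graft P P ?s V1 m (\<pi>, f, deriv_prod P \<eta> (blk ` \<pi>) ((K1, K2), (a, (\<kappa>, g, b))))"
  proof -
    have "repoint P (blk ` \<pi>) (blk B0) (deriv_prod P \<eta> (blk ` \<pi>) ((K1, K2), (a, (\<kappa>, g, b)))) =
        \<eta> (insert (blk B0) (blk ` \<pi>)) (graft P P (blk B0) K1 a (\<kappa>, g, b))"
      using repoint_deriv_prod[OF finK K(2) _ a t, of "blk B0"] bB0 by (simp add: K(1))
    moreover have "restrict (f(B0 := m0)) (insert B0 \<pi>) = f(B0 := m0)"
      using f by (auto simp: PiE_iff extensional_def fun_eq_iff)
    ultimately show ?thesis
      unfolding z_def subst_mor_def mor_id_def graft_def[of P P ?s] prod.case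
        B0_def[symmetric] m0_def[symmetric] by simp
  qed
  also have "\<eta> (plus_star V) \<dots> = deriv_prod P \<eta> V ((V1, W),
      (m, (\<pi>, f, deriv_prod P \<eta> (blk ` \<pi>) ((K1, K2), (a, (\<kappa>, g, b))))))"
    by (rule deriv_prod_eq[OF fin, symmetric]) (use UW V f in \<open>auto simp: PiE_iff\<close>)
  finally show ?thesis unfolding U_def .
qed

end

section \<open>The monop axioms, read off from the statements on elements\<close>

theorem theorem6p2:
  fixes P :: "('a, 's) species"
    and \<eta> :: "('a, ('a, 's, 's) subst_str, 's) mor"
    and e :: "('a, 'a label, 's) mor"
  assumes "operad P \<eta> e"
  shows "monop (deriv P, P)
           (deriv_mor \<eta> \<circ>\<^sub>s chain_rule P P \<circ>\<^sub>s prod_swap, \<eta>)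
           (deriv_mor e \<circ>\<^sub>s one_deriv_X, e)"
proof -
  note op = assms
  note species = operad_species[OF op]
  have pos: "positive P" using op by (simp add: operad_def)
  let ?e = "deriv_mor e \<circ>\<^sub>s one_deriv_X"
  have assoc: "mor_eq (sp_prod (deriv P) (sp_subst (sp_prod (deriv P) (sp_subst (deriv P) P)) P))
      (deriv_prod P \<eta> \<circ>\<^sub>s prod_mor (deriv_prod P \<eta>) (subst_mor mor_id \<eta>) \<circ>\<^sub>s
        (prod_assoc \<circ>\<^sub>s prod_mor mor_id (prod_mor mor_id (subst_assoc (deriv P))) \<circ>\<^sub>s
          prod_mor mor_id subst_distrib))
      (deriv_prod P \<eta> \<circ>\<^sub>s prod_mor mor_id (subst_mor (deriv_prod P \<eta>) mor_id))"
    unfolding mor_eq_def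
  proof (intro allI impI ballI)
    fix V :: "'a label set" and s
    assume fin: "finite V"
      and s: "s \<in> str (sp_prod (deriv P) (sp_subst (sp_prod (deriv P) (sp_subst (deriv P) P)) P)) V"
    obtain V1 W m \<pi> f K1 K2 a \<kappa> g b
      where seq: "s = ((V1, W), (m, (\<pi>, f, ((K1, K2), (a, (\<kappa>, g, b))))))"
      by (metis prod.exhaust)
    have *: "V = V1 \<union> W" "V1 \<inter> W = {}" "m \<in> str (deriv P) V1" "partition_on W \<pi>"
      "f \<in> (\<Pi>\<^sub>E B\<in>\<pi>. str P B)" "K1 \<union> K2 = blk ` \<pi>" "K1 \<inter> K2 = {}" "a \<in> str (deriv P) K1"
      "(\<kappa>, g, b) \<in> str (sp_subst (deriv P) P) K2"
      using s unfolding seq in_str_prod in_str_subst by auto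
    \<comment> \<open>Substituting the identity morphism on the right side restricts the family to
      \<open>\<pi>\<close>, which changes nothing for an extensional family.\<close>
    have "restrict f \<pi> = f" using *(5) by (simp add: PiE_restrict)
    then show "(deriv_prod P \<eta> \<circ>\<^sub>s prod_mor (deriv_prod P \<eta>) (subst_mor mor_id \<eta>) \<circ>\<^sub>s
        (prod_assoc \<circ>\<^sub>s prod_mor mor_id (prod_mor mor_id (subst_assoc (deriv P))) \<circ>\<^sub>s
          prod_mor mor_id subst_distrib)) V s =
      (deriv_prod P \<eta> \<circ>\<^sub>s prod_mor mor_id (subst_mor (deriv_prod P \<eta>) mor_id)) V s"
      using deriv_prod_assoc[OF op fin * refl refl]
      unfolding seq mor_comp_def prod_mor_def prod_assoc_def subst_distrib_def mor_id_def
        subst_mor_def[of "deriv_prod P \<eta>"] Let_def prod.case by simp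
  qed
  have lunit: "mor_eq (sp_prod sp_one (sp_subst (deriv P) sp_X))
      (deriv_prod P \<eta> \<circ>\<^sub>s prod_mor ?e (subst_mor mor_id e)) (subst_runit (deriv P) \<circ>\<^sub>s prod_lunit)"
    unfolding mor_eq_def
  proof (intro allI impI ballI)
    fix V :: "'a label set" and s
    assume fin: "finite V" and s: "s \<in> str (sp_prod sp_one (sp_subst (deriv P) sp_X)) V"
    obtain V1 W z t where seq: "s = ((V1, W), (z, t))" by (metis prod.exhaust)
    have "V1 = {}" "W = V" "t \<in> str (sp_subst (deriv P) sp_X) V"
      using s unfolding seq in_str_prod by (auto simp: sp_one_def split: if_splits)
    then show "(deriv_prod P \<eta> \<circ>\<^sub>s prod_mor ?e (subst_mor mor_id e)) V s =
        (subst_runit (deriv P) \<circ>\<^sub>s prod_lunit) V s"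
      using deriv_prod_lunit[OF op fin, of t]
      unfolding seq mor_comp_def[of _ _ V] prod_mor_def prod_lunit_def prod.case
      by (simp add: deriv_unit_eq[OF op])
  qed
  have runit: "mor_eq (sp_prod (deriv P) (sp_subst sp_one P))
      (deriv_prod P \<eta> \<circ>\<^sub>s prod_mor mor_id (subst_mor ?e mor_id))
      (prod_runit \<circ>\<^sub>s prod_mor mor_id subst_one)"
    unfolding mor_eq_def
  proof (intro allI impI ballI)
    fix V :: "'a label set" and s
    assume fin: "finite V" and s: "s \<in> str (sp_prod (deriv P) (sp_subst sp_one P)) V"
    obtain V1 W m \<pi> f z where seq: "s = ((V1, W), (m, (\<pi>, f, z)))" by (metis prod.exhaust)
    \<comment> \<open>The species \<open>1\<close> has structures on the empty set only, so there
      are no blocks and \<open>W\<close> is empty.\<close>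
    have m: "m \<in> str (deriv P) V1" and \<pi>: "\<pi> = {}" and "V1 \<union> W = V" "partition_on W \<pi>"
      using s unfolding seq in_str_prod in_str_subst by (auto simp: sp_one_def split: if_splits)
    then have "W = {}" "V1 = V" by (auto simp: partition_on_def)
    then show "(deriv_prod P \<eta> \<circ>\<^sub>s prod_mor mor_id (subst_mor ?e mor_id)) V s =
        (prod_runit \<circ>\<^sub>s prod_mor mor_id subst_one) V s"
      using deriv_prod_runit[OF op fin, of m] m \<pi>
      unfolding seq mor_comp_def[of _ _ V] prod_mor_def prod_runit_def subst_mor_def mor_id_def prod.case
      by (simp add: deriv_unit_eq[OF op] restrict_def)
  qed
  \<comment> \<open>The second components of the monop axioms are the operad axioms
    themselves.\<close>
  show ?thesis
    using op assoc lunit runit species pos is_species_deriv[OF species] is_mor_deriv_prod[OF op]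
      is_mor_deriv_unit[OF op] operad_mor_prod[OF op] operad_mor_unit[OF op]
    unfolding deriv_prod_def[symmetric] monop_def riordan_id_def riordan_unit_def riordan_runit_def
    by (simp add: operad_def)
qed

end
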